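(* Let $(X,d,\mu)$ be a space of homogeneous type such that every $d$-ball is an open set, and let $E$ be a non-empty subset of $X$. Then the following statements are equivalent: (I) $E$ is weakly porous (with respect to $d$ and $\mu$) and the maximal $E$-free hole function $\rho_{d,E}$ is doubling; (II) there is some $\alpha>0$ such that $d(\cdot,E)^{-\alpha}\in A_1(X,d,\mu)$.
   Context: A quasi-distance on a non-empty set $X$ is a function $d:X\times X\to[0,\infty)$ with $d(x,y)=0$ iff $x=y$, $d(x,y)=d(y,x)$, and $d(x,z)\le K[d(x,y)+d(y,z)]$ for all $x,y,z\in X$ and some constant $K$. $K_d$ denotes the least $K\ge 1$ for which the last inequality holds. Balls are $B_d(x,r)=\{y\in X: d(x,y)<r\}$, $x\in X$, $r>0$. The topology on $X$ is $\tau_d=\{A\subset X:\ \forall x\in A\ \exists r>0,\ B_d(x,r)\subset A\}$. Space of homogeneous type: a triple $(X,d,\mu)$ where $d$ is a quasi-distance on $X$ whose balls are open and $\mu$ is a Borel measure such that, for some constant $A>0$, $0<\mu(B_d(x,2r))\le A\,\mu(B_d(x,r))<\infty$ for all $x\in X$, $r>0$. $d(x,E)=\inf_{e\in E}d(x,e)$. For $\alpha>0$, $d(x,E)^{-\alpha}$ is taken to be $+\infty$ where $d(x,E)=0$. $A_1$ class: a weight is a nonnegative measurable function $w$ with $\int_{B_d(x,r)}w\,d\mu<\infty$ for all $x\in X$, $r>0$. A weight $w$ belongs to $A_1(X,d,\mu)$ if there is $C>0$ with $\frac{1}{\mu(B_d(x,r))}\int_{B_d(x,r)}w\,d\mu\le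 C\,\operatorname{ess\,inf}_{y\in B_d(x,r)}w(y)$ for all $x\in X$, $r>0$. Maximal $E$-free hole function: for a ball $B_d(x,r)$ (with given center and radius) let $\Lambda(x,r;d,E)=\{0<s\le 2K_dr:\ \exists y\in X,\ B_d(y,s)\subset B_d(x,r)\setminus E\}$ and $\rho_{d,E}(B_d(x,r))=\sup\Lambda(x,r;d,E)$, with value $0$ if $\Lambda(x,r;d,E)=\emptyset$. The function $\rho_{d,E}$ is doubling if there is a constant $C_{d,E}>0$ with $\rho_{d,E}(B_d(x,2r))\le C_{d,E}\,\rho_{d,E}(B_d(x,r))$ for all $x\in X$, $r>0$. Weak porosity: a non-empty $E\subset X$ is $(\sigma,\gamma)$-weakly porous with respect to $d$ and $\mu$, where $\sigma,\gamma\in(0,1)$, if for every ball $B=B_d(x,r)$ there is a finite collection of balls $\{B_d(x_i,r_i)\}_{i=1}^N$ ($N$ depending on $B$) such that: (i) the balls $B_d(x_i,r_i)$ are pairwise disjoint and each is contained in $B\setminus E$; (ii) $r_i\ge\gamma\rho_{d,E}(B)$ for all $i$; (iii) $r_i\le 2K_dr$ for all $i$; (iv) $\sum_{i=1}^N\mu(B_d(x_i,r_i))\ge\sigma\mu(B)$. $E$ is weakly porous if this holds for some $\sigma,\gamma\in(0,1)$. *)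

theory Defs
  imports "HOL-Analysis.Analysis"
begin

definition quasi_triangle :: "'a set \<Rightarrow> ('a \<Rightarrow> 'a \<Rightarrow> real) \<Rightarrow> real \<Rightarrow> bool" where
  "quasi_triangle X d K \<longleftrightarrow> (\<forall>x\<in>X. \<forall>y\<in>X. \<forall>z\<in>X. d x z \<le> K * (d x y + d y z))"

definition quasi_distance :: "'a set \<Rightarrow> ('a \<Rightarrow> 'a \<Rightarrow> real) \<Rightarrow> bool" where
  "quasi_distance X d \<longleftrightarrow>
     X \<noteq> {} \<and>
     (\<forall>x\<in>X. \<forall>y\<in>X. 0 \<le> d x y) \<and>
     (\<forall>x\<in>X. \<forall>y\<in>X. d x y = 0 \<longleftrightarrow> x = y) \<and>
     (\<forall>x\<in>X. \<forall>y\<in>X. d x y = d y x) \<and>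
     (\<exists>K. quasi_triangle X d K)"

definition qconst :: "'a set \<Rightarrow> ('a \<Rightarrow> 'a \<Rightarrow> real) \<Rightarrow> real" where
  "qconst X d = (LEAST K. 1 \<le> K \<and> quasi_triangle X d K)"

text \<open>A real-valued \<open>LEAST\<close> need not be attained in general; here it is.\<close>

lemma qconst_least:
  assumes "quasi_distance X d"
  shows "1 \<le> qconst X d" "quasi_triangle X d (qconst X d)"
    "\<And>K. 1 \<le> K \<Longrightarrow> quasi_triangle X d K \<Longrightarrow> qconst X d \<le> K"
proof -
  define S where "S = {K. 1 \<le> K \<and> quasi_triangle X d K}"
  from assms obtain K where K: "quasi_triangle X d K"
    by (auto simp: quasi_distance_def)
  have nn: "0 \<le> d x y + d y z" if "x \<in> X" "y \<in> X" "z \<in> X" for x y z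
    using assms that by (auto simp: quasi_distance_def)
  have "quasi_triangle X d (max 1 K)"
    unfolding quasi_triangle_def
  proof (intro ballI)
    fix x y z assume xyz: "x \<in> X" "y \<in> X" "z \<in> X"
    have "d x z \<le> K * (d x y + d y z)"
      using K xyz by (auto simp: quasi_triangle_def)
    also have "\<dots> \<le> max 1 K * (d x y + d y z)"
      using nn[OF xyz] by (intro mult_right_mono) auto
    finally show "d x z \<le> max 1 K * (d x y + d y z)" .
  qed
  then have "S \<noteq> {}" by (auto simp: S_def intro!: exI[of _ "max 1 K"])
  moreover have "bdd_below S" by (auto simp: S_def intro!: bdd_belowI[of _ 1])
  moreover have "closed S"
    unfolding S_def quasi_triangle_def Ball_def
    by (intro closed_Collect_conj closed_Collect_all closed_Collect_imp closed_Collect_le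
        continuous_intros open_Collect_const)
  ultimately have Inf: "Inf S \<in> S" "\<And>K. K \<in> S \<Longrightarrow> Inf S \<le> K"
    by (auto intro: closed_contains_Inf cInf_lower)
  have "qconst X d = Inf S"
    unfolding qconst_def using Inf by (intro Least_equality) (auto simp: S_def)
  then show "1 \<le> qconst X d" "quasi_triangle X d (qconst X d)"
    "\<And>K. 1 \<le> K \<Longrightarrow> quasi_triangle X d K \<Longrightarrow> qconst X d \<le> K"
    using Inf by (auto simp: S_def)
qed

definition qball :: "'a set \<Rightarrow> ('a \<Rightarrow> 'a \<Rightarrow> real) \<Rightarrow> 'a \<Rightarrow> real \<Rightarrow> 'a set" where
  "qball X d x r = {y \<in> X. d x y < r}"

definition qopen :: "'a set \<Rightarrow> ('a \<Rightarrow> 'a \<Rightarrow> real) \<Rightarrow> 'a set set" where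
  "qopen X d = {A. A \<subseteq> X \<and> (\<forall>x\<in>A. \<exists>r>0. qball X d x r \<subseteq> A)}"

definition homogeneous_type :: "'a set \<Rightarrow> ('a \<Rightarrow> 'a \<Rightarrow> real) \<Rightarrow> 'a measure \<Rightarrow> bool" where
  "homogeneous_type X d M \<longleftrightarrow>
     quasi_distance X d \<and>
     (\<forall>x\<in>X. \<forall>r>0. qball X d x r \<in> qopen X d) \<and>
     space M = X \<and> sets M = sigma_sets X (qopen X d) \<and>
     (\<exists>A>0. \<forall>x\<in>X. \<forall>r>0.
        0 < emeasure M (qball X d x (2 * r)) \<and>
        emeasure M (qball X d x (2 * r)) \<le> ennreal A * emeasure M (qball X d x r) \<and>
        ennreal A * emeasure M (qball X d x r) < \<infinity>)"

definition qdist_set :: "('a \<Rightarrow> 'a \<Rightarrow> real) \<Rightarrow> 'a \<Rightarrow> 'a set \<Rightarrow> real" where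
  "qdist_set d x E = (INF e\<in>E. d x e)"

definition dist_power_weight :: "('a \<Rightarrow> 'a \<Rightarrow> real) \<Rightarrow> 'a set \<Rightarrow> real \<Rightarrow> 'a \<Rightarrow> ennreal" where
  "dist_power_weight d E \<alpha> x =
     (if qdist_set d x E = 0 then \<infinity> else ennreal (qdist_set d x E powr (- \<alpha>)))"

definition ess_inf_on :: "'a measure \<Rightarrow> 'a set \<Rightarrow> ('a \<Rightarrow> ennreal) \<Rightarrow> ennreal" where
  "ess_inf_on M B w = Sup {c. AE y in M. y \<in> B \<longrightarrow> c \<le> w y}"

definition weight :: "'a set \<Rightarrow> ('a \<Rightarrow> 'a \<Rightarrow> real) \<Rightarrow> 'a measure \<Rightarrow> ('a \<Rightarrow> ennreal) \<Rightarrow> bool" where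
  "weight X d M w \<longleftrightarrow>
     w \<in> borel_measurable M \<and>
     (\<forall>x\<in>X. \<forall>r>0. set_nn_integral M (qball X d x r) w < \<infinity>)"

definition A1_class :: "'a set \<Rightarrow> ('a \<Rightarrow> 'a \<Rightarrow> real) \<Rightarrow> 'a measure \<Rightarrow> ('a \<Rightarrow> ennreal) set" where
  "A1_class X d M = {w. weight X d M w \<and>
     (\<exists>C>0. \<forall>x\<in>X. \<forall>r>0.
        set_nn_integral M (qball X d x r) w / emeasure M (qball X d x r)
          \<le> ennreal C * ess_inf_on M (qball X d x r) w)}"

definition hole_radii :: "'a set \<Rightarrow> ('a \<Rightarrow> 'a \<Rightarrow> real) \<Rightarrow> 'a set \<Rightarrow> 'a \<Rightarrow> real \<Rightarrow> real set" where
  "hole_radii X d E x r =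
     {s. 0 < s \<and> s \<le> 2 * qconst X d * r \<and> (\<exists>y\<in>X. qball X d y s \<subseteq> qball X d x r - E)}"

text \<open>A function of center and radius, which the set \<open>qball X d x r\<close> need not determine.\<close>

definition hole_fun :: "'a set \<Rightarrow> ('a \<Rightarrow> 'a \<Rightarrow> real) \<Rightarrow> 'a set \<Rightarrow> 'a \<Rightarrow> real \<Rightarrow> real" where
  "hole_fun X d E x r =
     (if hole_radii X d E x r = {} then 0 else Sup (hole_radii X d E x r))"

definition hole_doubling :: "'a set \<Rightarrow> ('a \<Rightarrow> 'a \<Rightarrow> real) \<Rightarrow> 'a set \<Rightarrow> bool" where
  "hole_doubling X d E \<longleftrightarrow>
     (\<exists>C>0. \<forall>x\<in>X. \<forall>r>0. hole_fun X d E x (2 * r) \<le> C * hole_fun X d E x r)"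

definition weakly_porous_with ::
  "'a set \<Rightarrow> ('a \<Rightarrow> 'a \<Rightarrow> real) \<Rightarrow> 'a measure \<Rightarrow> 'a set \<Rightarrow> real \<Rightarrow> real \<Rightarrow> bool" where
  "weakly_porous_with X d M E \<sigma> \<gamma> \<longleftrightarrow>
     E \<noteq> {} \<and> E \<subseteq> X \<and>
     (\<forall>x\<in>X. \<forall>r>0. \<exists>(N::nat) (c::nat \<Rightarrow> 'a) (\<rho>::nat \<Rightarrow> real).
        (\<forall>i\<in>{1..N}. c i \<in> X \<and> 0 < \<rho> i) \<and>
        disjoint_family_on (\<lambda>i. qball X d (c i) (\<rho> i)) {1..N} \<and>
        (\<forall>i\<in>{1..N}. qball X d (c i) (\<rho> i) \<subseteq> qball X d x r - E) \<and>
        (\<forall>i\<in>{1..N}. \<rho> i \<ge> \<gamma> * hole_fun X d E x r) \<and>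
        (\<forall>i\<in>{1..N}. \<rho> i \<le> 2 * qconst X d * r) \<and>
        (\<Sum>i=1..N. emeasure M (qball X d (c i) (\<rho> i))) \<ge> ennreal \<sigma> * emeasure M (qball X d x r))"

definition weakly_porous ::
  "'a set \<Rightarrow> ('a \<Rightarrow> 'a \<Rightarrow> real) \<Rightarrow> 'a measure \<Rightarrow> 'a set \<Rightarrow> bool" where
  "weakly_porous X d M E \<longleftrightarrow>
     (\<exists>\<sigma>\<in>{0<..<1}. \<exists>\<gamma>\<in>{0<..<1}. weakly_porous_with X d M E \<sigma> \<gamma>)"

end

theory Submission
  imports Defs
begin

text \<open>
Write \<open>B x r\<close> for balls, \<open>\<delta> z\<close> for the distance from \<open>z\<close> to \<open>E\<close>, \<open>h x r\<close> for the radius of the maximal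
\<open>E\<close>-free hole of \<open>B x r\<close>, and \<open>w \<alpha>\<close> for the weight \<open>\<delta> powr - \<alpha>\<close>. Both directions compare the average of
the weight over a ball with \<open>h x r powr - \<alpha>\<close>.

Suppose \<open>w \<alpha>\<close> is in \<open>A\<^sub>1\<close>. The weight is at most a multiple of \<open>s powr - \<alpha>\<close> in the middle of a hole of
radius \<open>s\<close>, so the \<open>A\<^sub>1\<close> condition bounds its average over the ball that contains the hole. By Chebyshev's
inequality \<open>\<delta>\<close> is at least a multiple of \<open>s\<close> on half of any concentric ball of comparable radius
(\<open>A1_imp_dist_large\<close>). A single such point in a smaller ball is the centre of a hole there, which
gives doubling; a disjoint family of balls of one fixed radius centred at such points gives weak
porosity.

Conversely, suppose \<open>E\<close> is weakly porous and \<open>h\<close> is doubling. Fix a small \<open>t\<close> and a point \<open>y\<close> with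
\<open>\<delta> y < t\<close>. Halve the radius of a ball around \<open>y\<close> until its maximal hole has radius at most \<open>t\<close>. Doubling
excludes jumps of \<open>h\<close>, so that the maximal hole then has radius comparable with \<open>t\<close>; this has two consequences
(\<open>ball_in_annulus\<close>): \<open>\<delta>\<close> is at most a multiple of \<open>t\<close> on the whole ball, and weak porosity makes \<open>\<delta>\<close> at
least a multiple of \<open>t\<close> on a fixed fraction of it. A Vitali covering by such balls
shows that the measure of \<open>{\<delta> < t}\<close> is at most a multiple of the measure of an annulus
\<open>{l * t \<le> \<delta> < L * t}\<close>. Hence the measure of \<open>{\<delta> < t}\<close> drops by a fixed factor \<open>\<theta> < 1\<close> whenever \<open>t\<close> is
multiplied by a suitable \<open>\<tau> < 1\<close> (\<open>near_measure_decay\<close>). The covering leaves the given ball, by an amount that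
decreases geometrically with \<open>t\<close>, fast enough for all enlargements to stay in one fixed multiple
of the ball. Summing over the layers \<open>\<tau> ^ Suc i * u \<le> \<delta> < \<tau> ^ i * u\<close> bounds the average of \<open>w \<alpha>\<close> by a multiple of
\<open>h x r powr - \<alpha>\<close> as soon as \<open>\<tau> powr - \<alpha> * \<theta> < 1\<close>. If the ball is not far from \<open>E\<close>, its points
satisfy \<open>\<delta> \<le> L * h x r\<close> by doubling, so this is the \<open>A\<^sub>1\<close> bound; otherwise \<open>\<delta>\<close> is almost
constant on the ball.
\<close>

section \<open>Quasi-metric spaces and a Vitali covering\<close>

locale quasi_space =
  fixes X :: "'a set" and d :: "'a \<Rightarrow> 'a \<Rightarrow> real"
  assumes quasi_dist: "quasi_distance X d"
begin

abbreviation K :: real where "K \<equiv> qconst X d"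
abbreviation B :: "'a \<Rightarrow> real \<Rightarrow> 'a set" where "B \<equiv> qball X d"

lemma K_ge_1: "1 \<le> K" and K_pos: "0 < K"
  using qconst_least(1)[OF quasi_dist] by auto

lemma d_nonneg: "x \<in> X \<Longrightarrow> y \<in> X \<Longrightarrow> 0 \<le> d x y"
  and d_self: "x \<in> X \<Longrightarrow> d x x = 0"
  and d_commute: "x \<in> X \<Longrightarrow> y \<in> X \<Longrightarrow> d x y = d y x"
  using quasi_dist by (auto simp: quasi_distance_def)

lemma d_triangle: "x \<in> X \<Longrightarrow> y \<in> X \<Longrightarrow> z \<in> X \<Longrightarrow> d x z \<le> K * (d x y + d y z)"
  using qconst_least(2)[OF quasi_dist] by (auto simp: quasi_triangle_def)

lemma d_triangle_less:
  assumes "x \<in> X" "y \<in> X" "z \<in> X" "d x y < a" "d y z < b" "K * (a + b) \<le> c"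
  shows "d x z < c"
proof -
  have "d x z \<le> K * (d x y + d y z)" using assms by (intro d_triangle)
  also have "\<dots> < K * (a + b)" using assms K_pos by (intro mult_strict_left_mono) auto
  finally show ?thesis using assms by simp
qed

lemma ball_subset_space: "B x r \<subseteq> X"
  by (auto simp: qball_def)

lemma center_in_ball: "x \<in> X \<Longrightarrow> 0 < r \<Longrightarrow> x \<in> B x r"
  by (simp add: qball_def d_self)

lemma ball_mono: "r \<le> s \<Longrightarrow> B x r \<subseteq> B x s"
  by (auto simp: qball_def)

lemma ball_subset_ball:
  assumes "x \<in> X" "y \<in> X" "d x y < a" "K * (a + s) \<le> r"
  shows "B y s \<subseteq> B x r"
  using assms by (auto simp: qball_def intro: d_triangle_less[of x y _ a s r])

text \<open>The family is chosen maximal among those disjoint families such that every ball meeting the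
  family meets a member at least half as large; maximality then gives the covering, since otherwise
  among the balls disjoint from the family one of more than half the supremal radius could be added.\<close>

lemma vitali_covering:
  assumes S: "S \<subseteq> X" and f: "\<And>y. y \<in> S \<Longrightarrow> 0 < f y" and bound: "\<And>y. y \<in> S \<Longrightarrow> f y \<le> R"
  obtains J where "J \<subseteq> S" "disjoint_family_on (\<lambda>y. B y (f y)) J"
    "S \<subseteq> (\<Union>y\<in>J. B y (3 * K * f y))"
proof -
  define meets where "meets x y \<longleftrightarrow> B x (f x) \<inter> B y (f y) \<noteq> {}" for x y
  define \<A> where "\<A> = {C. C \<subseteq> S \<and> disjoint_family_on (\<lambda>y. B y (f y)) C \<and>
     (\<forall>x\<in>S. (\<exists>y\<in>C. meets x y) \<longrightarrow> (\<exists>y\<in>C. meets x y \<and> f x \<le> 2 * f y))}"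
  have chain: "\<Union>\<C> \<in> \<A>" if "subset.chain \<A> \<C>" for \<C>
  proof -
    have sub: "C \<in> \<A>" if "C \<in> \<C>" for C
      using that \<open>subset.chain \<A> \<C>\<close> by (auto simp: subset.chain_def)
    have "disjoint_family_on (\<lambda>y. B y (f y)) (\<Union>\<C>)"
      unfolding disjoint_family_on_def
    proof (intro ballI impI)
      fix a b assume "a \<in> \<Union>\<C>" "b \<in> \<Union>\<C>" "a \<noteq> b"
      then obtain C where "C \<in> \<C>" "a \<in> C" "b \<in> C"
        using \<open>subset.chain \<A> \<C>\<close> unfolding subset.chain_def by blast
      with sub[of C] \<open>a \<noteq> b\<close> show "B a (f a) \<inter> B b (f b) = {}"
        by (auto simp: \<A>_def disjoint_family_on_def)
    qed
    moreover have "\<exists>y\<in>\<Union>\<C>. meets x y \<and> f x \<le> 2 * f y"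
      if xy: "x \<in> S" "y \<in> \<Union>\<C>" "meets x y" for x y
    proof -
      obtain C where C: "C \<in> \<C>" "y \<in> C" using xy by auto
      then have "\<exists>y\<in>C. meets x y \<and> f x \<le> 2 * f y"
        using sub[of C] xy unfolding \<A>_def by blast
      then show ?thesis using C by blast
    qed
    moreover have "\<Union>\<C> \<subseteq> S"
      using sub by (auto simp: \<A>_def)
    ultimately show ?thesis
      unfolding \<A>_def by blast
  qed
  obtain J where J: "J \<in> \<A>" and max: "\<And>C. C \<in> \<A> \<Longrightarrow> J \<subseteq> C \<Longrightarrow> C = J"
    using subset_Zorn'[OF chain] by metis
  have J': "J \<subseteq> S" "disjoint_family_on (\<lambda>y. B y (f y)) J"
    "\<And>x y. x \<in> S \<Longrightarrow> y \<in> J \<Longrightarrow> meets x y \<Longrightarrow> \<exists>y\<in>J. meets x y \<and> f x \<le> 2 * f y"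
    using J by (auto simp: \<A>_def)
  have meets_self: "meets x x" if "x \<in> S" for x
    using that center_in_ball[of x "f x"] f S by (auto simp: meets_def)
  have meets_J: "\<exists>y\<in>J. meets x y" if "x \<in> S" for x
  proof (rule ccontr)
    assume *: "\<not> (\<exists>y\<in>J. meets x y)"
    define T where "T = {x\<in>S. \<forall>y\<in>J. \<not> meets x y}"
    have "x \<in> T" using * that by (auto simp: T_def)
    have bdd: "bdd_above (f ` T)" using bound by (intro bdd_aboveI2[of _ _ R]) (auto simp: T_def)
    have "0 < f x" using f that by auto
    also have "f x \<le> Sup (f ` T)" using \<open>x \<in> T\<close> bdd by (intro cSUP_upper)
    finally have "Sup (f ` T) / 2 < Sup (f ` T)" by simp
    then obtain z where z: "z \<in> T" "Sup (f ` T) / 2 < f z"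
      using less_cSUP_iff[OF _ bdd] \<open>x \<in> T\<close> by blast
    have big: "f u \<le> 2 * f z" if "u \<in> T" for u
      using cSUP_upper[OF that bdd] z by linarith
    have "insert z J \<in> \<A>"
      unfolding \<A>_def
    proof (intro CollectI conjI ballI impI)
      show "insert z J \<subseteq> S" using J' z by (auto simp: T_def)
      show "disjoint_family_on (\<lambda>y. B y (f y)) (insert z J)"
        using J'(2) z(1) by (fastforce simp: disjoint_family_on_def T_def meets_def)
      fix u assume u: "u \<in> S" "\<exists>y\<in>insert z J. meets u y"
      show "\<exists>y\<in>insert z J. meets u y \<and> f u \<le> 2 * f y"
      proof (cases "u \<in> T")
        case True
        then show ?thesis using u big by (auto simp: T_def)
      next
        case False
        then show ?thesis using u J'(3)[of u] by (auto simp: T_def)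
      qed
    qed
    then have "z \<in> J" using max by blast
    then show False using z meets_self by (auto simp: T_def)
  qed
  have "S \<subseteq> (\<Union>y\<in>J. B y (3 * K * f y))"
  proof
    fix x assume x: "x \<in> S"
    then obtain y where y: "y \<in> J" "meets x y" "f x \<le> 2 * f y"
      using meets_J J'(3) by blast
    then obtain z where z: "z \<in> X" "d x z < f x" "d y z < f y"
      by (auto simp: meets_def qball_def)
    have "y \<in> X" "x \<in> X" using y x J' S by auto
    then have "d y x < 3 * K * f y"
      using z y K_pos by (intro d_triangle_less[of y z x "f y" "f x"]) (auto simp: d_commute)
    then show "x \<in> (\<Union>y\<in>J. B y (3 * K * f y))"
      using y \<open>x \<in> X\<close> by (auto simp: qball_def)
  qed
  then show ?thesis using that J' by blast
qed

end

section \<open>The distance to a set and its maximal holes\<close>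

locale quasi_space_subset = quasi_space X d for X :: "'a set" and d +
  fixes E :: "'a set"
  assumes E_subset: "E \<subseteq> X" and E_nonempty: "E \<noteq> {}"
begin

abbreviation \<delta> :: "'a \<Rightarrow> real" where "\<delta> z \<equiv> qdist_set d z E"
abbreviation h :: "'a \<Rightarrow> real \<Rightarrow> real" where "h \<equiv> hole_fun X d E"

lemma bdd_below_dist: "z \<in> X \<Longrightarrow> bdd_below (d z ` E)"
  using E_subset d_nonneg by (intro bdd_belowI2[of _ 0]) auto

lemma le_dist_iff: "z \<in> X \<Longrightarrow> c \<le> \<delta> z \<longleftrightarrow> (\<forall>e\<in>E. c \<le> d z e)"
  unfolding qdist_set_def using bdd_below_dist E_nonempty by (intro le_cINF_iff)

lemma dist_less_iff: "z \<in> X \<Longrightarrow> \<delta> z < c \<longleftrightarrow> (\<exists>e\<in>E. d z e < c)"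
  using le_dist_iff[of z c] by (meson linorder_not_le)

lemma dist_nonneg: "z \<in> X \<Longrightarrow> 0 \<le> \<delta> z"
  using E_subset d_nonneg by (auto simp: le_dist_iff)

lemma ball_disjoint_iff: "z \<in> X \<Longrightarrow> B z c \<inter> E = {} \<longleftrightarrow> c \<le> \<delta> z"
  using E_subset by (auto simp: le_dist_iff qball_def disjoint_iff not_less)

lemma dist_quasi_Lipschitz:
  assumes "x \<in> X" "z \<in> X"
  shows "\<delta> z \<le> K * (d z x + \<delta> x)"
proof -
  have "\<delta> z / K - d z x \<le> d x e" if "e \<in> E" for e
  proof -
    have "\<delta> z \<le> d z e" using that assms le_dist_iff by blast
    also have "\<dots> \<le> K * (d z x + d x e)" using that assms E_subset by (intro d_triangle) auto
    finally show ?thesis using K_pos by (simp add: field_simps)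
  qed
  then have "\<delta> z / K - d z x \<le> \<delta> x" using assms by (simp add: le_dist_iff)
  then show ?thesis using K_pos by (simp add: field_simps)
qed

definition near :: "real \<Rightarrow> 'a set" where "near t = {z \<in> X. \<delta> z < t}"

lemma near_eq_UN: "near t = (\<Union>e\<in>E. B e t)"
proof -
  have "d z e = d e z" if "z \<in> X" "e \<in> E" for z e
    using that E_subset d_commute by blast
  then show ?thesis
    by (auto simp: near_def dist_less_iff qball_def) metis+
qed

lemma near_mono: "s \<le> t \<Longrightarrow> near s \<subseteq> near t"
  by (auto simp: near_def)

lemma mem_hole_radii_iff:
  "s \<in> hole_radii X d E x r \<longleftrightarrow> 0 < s \<and> s \<le> 2 * K * r \<and> (\<exists>y\<in>X. B y s \<subseteq> B x r - E)"
  by (simp add: hole_radii_def)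

lemma bdd_above_hole_radii: "bdd_above (hole_radii X d E x r)"
  by (auto simp: hole_radii_def)

lemma hole_fun_ge: "s \<in> hole_radii X d E x r \<Longrightarrow> s \<le> h x r"
  using bdd_above_hole_radii by (auto simp: hole_fun_def intro: cSup_upper)

lemma hole_fun_nonneg: "0 \<le> h x r"
proof (cases "hole_radii X d E x r = {}")
  case False
  then obtain s where "s \<in> hole_radii X d E x r" by auto
  with hole_fun_ge[OF this] show ?thesis by (auto simp: hole_radii_def)
qed (simp add: hole_fun_def)

lemma hole_fun_le: "0 < r \<Longrightarrow> h x r \<le> 2 * K * r"
  using K_pos by (auto simp: hole_fun_def hole_radii_def intro!: cSup_least)

lemma hole_fun_approx:
  assumes "c < h x r" "0 \<le> c"
  obtains s where "s \<in> hole_radii X d E x r" "c < s"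
proof -
  have "hole_radii X d E x r \<noteq> {}" using assms by (auto simp: hole_fun_def)
  then show ?thesis
    using assms that less_cSup_iff[OF _ bdd_above_hole_radii] by (auto simp: hole_fun_def)
qed

lemma hole_fun_leI:
  assumes "\<And>s. s \<in> hole_radii X d E x r \<Longrightarrow> s \<le> b" "0 \<le> b"
  shows "h x r \<le> b"
proof (rule ccontr)
  assume "\<not> ?thesis"
  then obtain s where "s \<in> hole_radii X d E x r" "b < s"
    using hole_fun_approx[of b x r] assms(2) by auto
  with assms(1)[of s] show False by simp
qed

lemma hole_fun_mono:
  assumes "B x r \<subseteq> B y s" "r \<le> s"
  shows "h x r \<le> h y s"
proof (rule ccontr)
  assume "\<not> ?thesis"
  then obtain a where a: "a \<in> hole_radii X d E x r" "h y s < a"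
    using hole_fun_approx[of "h y s" x r] hole_fun_nonneg by auto
  have "2 * K * r \<le> 2 * K * s" using assms K_pos by simp
  then have "a \<in> hole_radii X d E y s"
    using a assms by (fastforce simp: mem_hole_radii_iff)
  then show False using hole_fun_ge a by fastforce
qed

text \<open>Points of the ball of radius \<open>r / (2 K)\<close> are centres of holes: the factor \<open>2 K\<close> leaves room for
  another ball of that radius inside \<open>B x r\<close>, and the size limit on hole radii is then met
  since \<open>K \<ge> 1\<close>.\<close>

lemma hole_radii_from_dist:
  assumes "x \<in> X" "0 < r" "y \<in> B x (r / (2 * K))" "0 < s" "s \<le> \<delta> y" "s \<le> r / (2 * K)"
  shows "B y s \<subseteq> B x r - E" "s \<in> hole_radii X d E x r"
proof -
  have y: "y \<in> X" "d x y < r / (2 * K)" using assms by (auto simp: qball_def)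
  have "K * (r / (2 * K) + s) \<le> K * (r / (2 * K) + r / (2 * K))"
    using assms K_pos by (intro mult_left_mono) auto
  also have "\<dots> = r" using K_pos by (simp add: field_simps)
  finally have "B y s \<subseteq> B x r" using y assms by (intro ball_subset_ball[of x y "r / (2 * K)"])
  moreover have "B y s \<inter> E = {}" using y assms ball_disjoint_iff by blast
  ultimately show sub: "B y s \<subseteq> B x r - E" by auto
  have "r \<le> 2 * K * r * (2 * K)"
  proof -
    have "1 * 1 \<le> 2 * K * (2 * K)" using K_ge_1 by (intro mult_mono) auto
    then show ?thesis using assms by (simp add: mult_le_cancel_right1 algebra_simps)
  qed
  then have "r / (2 * K) \<le> 2 * K * r" using K_pos by (simp add: divide_le_eq)
  then show "s \<in> hole_radii X d E x r"
    using sub y assms by (auto simp: mem_hole_radii_iff)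
qed

lemma hole_fun_ge_min_dist:
  assumes "x \<in> X" "0 < r" "y \<in> B x (r / (2 * K))"
  shows "min (\<delta> y) (r / (2 * K)) \<le> h x r"
proof (cases "0 < \<delta> y")
  case True
  then show ?thesis
    using assms hole_radii_from_dist[OF assms, of "min (\<delta> y) (r / (2 * K))"] K_pos
    by (intro hole_fun_ge) auto
next
  case False
  then show ?thesis using hole_fun_nonneg[of x r] by linarith
qed

text \<open>Inside the concentric ball with radius reduced by the factor \<open>2 K\<close>, a hole stays away from
  \<open>E\<close> by a distance comparable with its radius.\<close>

lemma dist_in_hole:
  assumes "y \<in> X" "B y s \<inter> E = {}" "z \<in> B y (s / (2 * K))"
  shows "s / (2 * K) \<le> \<delta> z"
proof -
  have z: "z \<in> X" "d y z < s / (2 * K)" using assms by (auto simp: qball_def)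
  have "s \<le> \<delta> y" using assms ball_disjoint_iff by blast
  also have "\<dots> \<le> K * (d y z + \<delta> z)" using dist_quasi_Lipschitz z assms by blast
  also have "\<dots> \<le> K * (s / (2 * K) + \<delta> z)" using z K_pos by (intro mult_left_mono) auto
  finally show ?thesis using K_pos by (simp add: field_simps)
qed

lemma shrunk_ball_subset:
  assumes "0 < s" shows "B y (s / (2 * K)) \<subseteq> B y s"
proof (rule ball_mono)
  have "s * 1 \<le> s * (2 * K)" using assms K_ge_1 by (intro mult_left_mono) auto
  then show "s / (2 * K) \<le> s" using K_pos by (simp add: divide_le_eq)
qed

end

section \<open>Doubling measures\<close>

lemma measure_UN_disjoint_family:
  assumes "finite I" "disjoint_family_on U I"
    and "\<And>i. i \<in> I \<Longrightarrow> S i \<subseteq> U i" "\<And>i. i \<in> I \<Longrightarrow> S i \<in> fmeasurable M"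
  shows "measure M (\<Union>i\<in>I. S i) = (\<Sum>i\<in>I. measure M (S i))"
proof (rule measure_UNION')
  show "pairwise (\<lambda>i j. disjnt (S i) (S j)) I"
  proof (rule pairwiseI)
    fix i j assume ij: "i \<in> I" "j \<in> I" "i \<noteq> j"
    then have "U i \<inter> U j = {}" using assms(2) by (auto simp: disjoint_family_on_def)
    then show "disjnt (S i) (S j)" using assms(3)[of i] assms(3)[of j] ij unfolding disjnt_def by blast
  qed
qed (use assms in auto)

locale homogeneous_space = quasi_space X d for X :: "'a set" and d +
  fixes M :: "'a measure"
  assumes homogeneous: "homogeneous_type X d M"
begin

lemma space_eq: "space M = X"
  using homogeneous by (simp add: homogeneous_type_def)

lemma ball_empty:
  assumes "x \<in> X" "r \<le> 0" shows "B x r = {}"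
proof -
  have "\<not> d x y < r" if "y \<in> X" for y
    using d_nonneg[of x y] that assms by linarith
  then show ?thesis by (auto simp: qball_def)
qed

lemma ball_open: "x \<in> X \<Longrightarrow> 0 < r \<Longrightarrow> B x r \<in> qopen X d"
  using homogeneous unfolding homogeneous_type_def by blast

lemma qopen_UN:
  assumes "\<And>i. i \<in> I \<Longrightarrow> U i \<in> qopen X d"
  shows "(\<Union>i\<in>I. U i) \<in> qopen X d"
  unfolding qopen_def
proof (intro CollectI conjI ballI)
  show "(\<Union>i\<in>I. U i) \<subseteq> X" using assms by (auto simp: qopen_def)
  fix x assume "x \<in> (\<Union>i\<in>I. U i)"
  then obtain i where i: "i \<in> I" "x \<in> U i" by auto
  then obtain r where "0 < r" "qball X d x r \<subseteq> U i"
    using assms[of i] by (auto simp: qopen_def)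
  then show "\<exists>r>0. qball X d x r \<subseteq> (\<Union>i\<in>I. U i)" using i by blast
qed

lemma qopen_measurable: "U \<in> qopen X d \<Longrightarrow> U \<in> sets M"
  using homogeneous by (simp add: homogeneous_type_def sigma_sets.Basic)

lemma ball_measurable [measurable]:
  assumes "x \<in> X" shows "B x r \<in> sets M"
proof (cases "0 < r")
  case True
  then show ?thesis using assms ball_open qopen_measurable by simp
qed (use assms ball_empty[of x r] in simp)

text \<open>The union may be uncountable; it is measurable because it is open.\<close>

lemma UN_balls_measurable:
  assumes "A \<subseteq> X" shows "(\<Union>x\<in>A. B x r) \<in> sets M"
proof (cases "0 < r")
  case True
  then have "B x r \<in> qopen X d" if "x \<in> A" for x
    using that assms by (intro ball_open) auto
  then have "(\<Union>x\<in>A. B x r) \<in> qopen X d"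
    by (rule qopen_UN)
  then show ?thesis by (rule qopen_measurable)
next
  case False
  then have "(\<Union>x\<in>A. B x r) = {}" using ball_empty assms by auto
  then show ?thesis by simp
qed

lemma ball_fmeasurable:
  assumes "x \<in> X" shows "B x r \<in> fmeasurable M"
proof (rule fmeasurableI2)
  obtain A where A: "0 < A" "\<And>x r. x \<in> X \<Longrightarrow> 0 < r \<Longrightarrow> ennreal A * emeasure M (B x r) < \<infinity>"
    using homogeneous unfolding homogeneous_type_def by blast
  have "ennreal A * emeasure M (B x (max r 1)) < \<infinity>" using A assms by auto
  with A(1) have "emeasure M (B x (max r 1)) < \<infinity>"
    by (auto simp: ennreal_mult_less_top)
  then show "B x (max r 1) \<in> fmeasurable M" using assms by (intro fmeasurableI) auto
  show "B x r \<subseteq> B x (max r 1)" by (intro ball_mono) simp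
qed (use assms in simp)

lemma measure_ball_pos:
  assumes "x \<in> X" "0 < r" shows "0 < measure M (B x r)"
proof -
  have "0 < emeasure M (B x (2 * (r / 2)))"
    using homogeneous assms unfolding homogeneous_type_def by (meson half_gt_zero)
  then show ?thesis
    using ball_fmeasurable[of x r] assms by (simp add: emeasure_eq_measure2)
qed

lemma fmeasurable_in_ball:
  "S \<in> sets M \<Longrightarrow> S \<subseteq> B x r \<Longrightarrow> x \<in> X \<Longrightarrow> S \<in> fmeasurable M"
  using ball_fmeasurable fmeasurableI2 by blast

lemma measure_double:
  obtains A where "1 \<le> A" "\<And>x r. x \<in> X \<Longrightarrow> 0 < r \<Longrightarrow> measure M (B x (2 * r)) \<le> A * measure M (B x r)"
proof -
  obtain A where A: "0 < A" "\<And>x r. x \<in> X \<Longrightarrow> 0 < r \<Longrightarrow>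
      emeasure M (B x (2 * r)) \<le> ennreal A * emeasure M (B x r)"
    using homogeneous unfolding homogeneous_type_def by blast
  have "measure M (B x (2 * r)) \<le> max 1 A * measure M (B x r)" if "x \<in> X" "0 < r" for x r
  proof -
    have "ennreal (measure M (B x (2 * r))) \<le> ennreal (A * measure M (B x r))"
      using A(2)[OF that] A(1) that(1) ball_fmeasurable
      by (simp add: emeasure_eq_measure2 ennreal_mult)
    then have "measure M (B x (2 * r)) \<le> A * measure M (B x r)"
      using A(1) by (subst (asm) ennreal_le_iff) auto
    also have "\<dots> \<le> max 1 A * measure M (B x r)" by (intro mult_right_mono) auto
    finally show ?thesis .
  qed
  then show ?thesis using that[of "max 1 A"] by simp
qed

lemma measure_doubling:
  obtains D where "1 \<le> D" "\<And>x r. x \<in> X \<Longrightarrow> 0 < r \<Longrightarrow> measure M (B x (c * r)) \<le> D * measure M (B x r)"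
proof -
  obtain A where A: "1 \<le> A" "\<And>x r. x \<in> X \<Longrightarrow> 0 < r \<Longrightarrow> measure M (B x (2 * r)) \<le> A * measure M (B x r)"
    using measure_double by blast
  have iter: "measure M (B x (2 ^ n * r)) \<le> A ^ n * measure M (B x r)" if "x \<in> X" "0 < r" for x r n
  proof (induction n)
    case (Suc n)
    have "measure M (B x (2 ^ Suc n * r)) \<le> A * measure M (B x (2 ^ n * r))"
      using A(2)[of x "2 ^ n * r"] that by (simp add: mult_ac)
    also have "\<dots> \<le> A * (A ^ n * measure M (B x r))"
      using Suc A(1) by (intro mult_left_mono) auto
    finally show ?case by (simp add: mult_ac)
  qed auto
  obtain n where n: "c < 2 ^ n" using real_arch_pow[of 2 c] by auto
  have "measure M (B x (c * r)) \<le> A ^ n * measure M (B x r)" if "x \<in> X" "0 < r" for x r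
  proof -
    have "measure M (B x (c * r)) \<le> measure M (B x (2 ^ n * r))"
      using that n by (intro measure_mono_fmeasurable ball_mono) (auto simp: ball_fmeasurable)
    with iter[OF that, of n] show ?thesis by simp
  qed
  then show ?thesis using that[of "A ^ n"] A(1) by simp
qed

text \<open>A disjoint family of balls in a set of finite measure is countable because the balls have
  positive measure, so the covering by enlarged balls can be measured. Half of the resulting series
  is already reached by a finite partial sum.\<close>

lemma finite_vitali:
  obtains C where "1 \<le> C" and
    "\<And>S f R x r. \<lbrakk>S \<in> sets M; x \<in> X; \<And>y. y \<in> S \<Longrightarrow> 0 < f y \<and> f y \<le> R \<and> B y (f y) \<subseteq> B x r\<rbrakk> \<Longrightarrow>
      \<exists>J\<subseteq>S. finite J \<and> disjoint_family_on (\<lambda>y. B y (f y)) J \<and>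
        measure M S \<le> C * (\<Sum>y\<in>J. measure M (B y (f y)))"
proof -
  obtain D where D: "1 \<le> D"
    "\<And>x r. x \<in> X \<Longrightarrow> 0 < r \<Longrightarrow> measure M (B x (3 * K * r)) \<le> D * measure M (B x r)"
    using measure_doubling by blast
  have *: "\<exists>J\<subseteq>S. finite J \<and> disjoint_family_on (\<lambda>y. B y (f y)) J \<and>
        measure M S \<le> 2 * D * (\<Sum>y\<in>J. measure M (B y (f y)))"
    if S: "S \<in> sets M" and x: "x \<in> X" and f: "\<And>y. y \<in> S \<Longrightarrow> 0 < f y \<and> f y \<le> R \<and> B y (f y) \<subseteq> B x r"
    for S f R x r
  proof (rule ccontr)
    assume contra: "\<not> ?thesis"
    have SX: "S \<subseteq> X" using S sets.sets_into_space space_eq by blast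
    have S_sub: "S \<subseteq> B x r" using f SX center_in_ball by blast
    obtain J where J: "J \<subseteq> S" "disjoint_family_on (\<lambda>y. B y (f y)) J"
      "S \<subseteq> (\<Union>y\<in>J. B y (3 * K * f y))"
      using vitali_covering[OF SX, of f R] f by blast
    have less: "2 * D * (\<Sum>y\<in>I. measure M (B y (f y))) < measure M S" if "I \<subseteq> J" "finite I" for I
    proof -
      have "disjoint_family_on (\<lambda>y. B y (f y)) I" using disjoint_family_on_mono[OF that(1) J(2)] .
      moreover have "I \<subseteq> S" using that J(1) by blast
      ultimately show ?thesis using contra that(2) not_le by blast
    qed
    have "countable {y\<in>J. measure M (B y (f y)) \<noteq> 0}"
    proof (rule summable_countable_real, rule nonneg_bdd_above_summable_on)
      show "bdd_above (sum (\<lambda>y. measure M (B y (f y))) ` {F. F \<subseteq> J \<and> finite F})"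
      proof (rule bdd_aboveI2)
        fix I assume I: "I \<in> {F. F \<subseteq> J \<and> finite F}"
        have "1 * (\<Sum>y\<in>I. measure M (B y (f y))) \<le> 2 * D * (\<Sum>y\<in>I. measure M (B y (f y)))"
          using D(1) by (intro mult_right_mono sum_nonneg) auto
        with less[of I] I show "(\<Sum>y\<in>I. measure M (B y (f y))) \<le> measure M S" by auto
      qed
    qed auto
    moreover have "{y\<in>J. measure M (B y (f y)) \<noteq> 0} = J"
    proof -
      have "measure M (B y (f y)) \<noteq> 0" if "y \<in> J" for y
      proof -
        have "y \<in> X" "0 < f y" using that J(1) SX f by auto
        then show ?thesis using measure_ball_pos[of y "f y"] by simp
      qed
      then show ?thesis by auto
    qed
    ultimately have "countable J" by simp
    have bound: "measure M (\<Union>y\<in>I. B y (3 * K * f y)) \<le> measure M S / 2" if I: "I \<subseteq> J" "finite I" for I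
    proof -
      have IX: "y \<in> X \<and> 0 < f y" if "y \<in> I" for y using that I J(1) SX f by blast
      have "measure M (\<Union>y\<in>I. B y (3 * K * f y)) \<le> (\<Sum>y\<in>I. measure M (B y (3 * K * f y)))"
        using I IX by (intro measure_UNION_le) auto
      also have "\<dots> \<le> (\<Sum>y\<in>I. D * measure M (B y (f y)))"
        using IX D(2) by (intro sum_mono) auto
      also have "\<dots> = D * (\<Sum>y\<in>I. measure M (B y (f y)))" by (simp add: sum_distrib_left)
      also have "\<dots> \<le> measure M S / 2" using less[OF I] by simp
      finally show ?thesis .
    qed
    have fm: "B y (3 * K * f y) \<in> fmeasurable M" if "y \<in> J" for y
      using that J(1) SX ball_fmeasurable by blast
    have "measure M S \<le> measure M (\<Union>y\<in>J. B y (3 * K * f y))"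
      using J(3) S fmeasurable_UN_bound[OF \<open>countable J\<close> fm bound]
      by (intro measure_mono_fmeasurable)
    also have "\<dots> \<le> measure M S / 2"
      using measure_UN_bound[OF \<open>countable J\<close> fm bound] .
    finally have "measure M S \<le> 0" by simp
    with less[of "{}"] show False by simp
  qed
  show ?thesis
  proof (rule that[of "2 * D"])
    show "1 \<le> 2 * D" using D(1) by simp
  qed (rule *)
qed

end

section \<open>Powers of the distance as weights\<close>

locale homogeneous_space_subset = quasi_space_subset X d E + homogeneous_space X d M
  for X :: "'a set" and d E M
begin

lemma near_measurable [measurable]: "near t \<in> sets M"
  unfolding near_eq_UN using UN_balls_measurable[OF E_subset] .

lemma dist_measurable: "\<delta> \<in> borel_measurable M"
proof (rule borel_measurableI_less)
  show "{z \<in> space M. \<delta> z < t} \<in> sets M" for t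
    using near_measurable[of t] by (simp add: near_def space_eq)
qed

abbreviation w :: "real \<Rightarrow> 'a \<Rightarrow> ennreal" where "w \<equiv> dist_power_weight d E"

lemma w_measurable [measurable]: "w \<alpha> \<in> borel_measurable M"
proof -
  note dist_measurable [measurable]
  show ?thesis unfolding dist_power_weight_def by measurable
qed

lemma w_le:
  assumes "0 < s" "s \<le> \<delta> z" "0 < \<alpha>"
  shows "w \<alpha> z \<le> ennreal (s powr - \<alpha>)"
  using assms by (auto simp: dist_power_weight_def intro!: powr_mono2' ennreal_leI)

lemma w_ge:
  assumes "z \<in> X" "\<delta> z \<le> s" "0 < \<alpha>"
  shows "ennreal (s powr - \<alpha>) \<le> w \<alpha> z"
proof (cases "\<delta> z = 0")
  case False
  then have "0 < \<delta> z" using dist_nonneg assms(1) by (simp add: order_less_le)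
  then show ?thesis
    using assms by (auto simp: dist_power_weight_def intro!: powr_mono2' ennreal_leI)
qed (simp add: dist_power_weight_def)

text \<open>The weight is small in the middle of a hole, which is a set of positive measure.\<close>

lemma ess_inf_le_hole:
  assumes "x \<in> X" "s \<in> hole_radii X d E x r" "0 < \<alpha>"
  shows "ess_inf_on M (B x r) (w \<alpha>) \<le> ennreal ((s / (2 * K)) powr - \<alpha>)"
  unfolding ess_inf_on_def
proof (rule Sup_least, clarify)
  obtain y where y: "y \<in> X" "B y s \<subseteq> B x r - E" "0 < s"
    using assms by (auto simp: hole_radii_def)
  define B' where "B' = B y (s / (2 * K))"
  have pos: "0 < measure M B'" unfolding B'_def using y K_pos by (intro measure_ball_pos) auto
  fix c assume c: "AE z in M. z \<in> B x r \<longrightarrow> c \<le> w \<alpha> z"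
  show "c \<le> ennreal ((s / (2 * K)) powr - \<alpha>)"
  proof (rule ccontr)
    assume *: "\<not> ?thesis"
    have small: "z \<in> B x r \<and> w \<alpha> z < c" if "z \<in> B'" for z
    proof
      show "z \<in> B x r" using that y shrunk_ball_subset[of s y] by (auto simp: B'_def)
      have "B y s \<inter> E = {}" using y by auto
      then have "s / (2 * K) \<le> \<delta> z" using y that by (intro dist_in_hole) (auto simp: B'_def)
      then have "w \<alpha> z \<le> ennreal ((s / (2 * K)) powr - \<alpha>)"
        using y K_pos assms by (intro w_le) auto
      with * show "w \<alpha> z < c" by simp
    qed
    have "AE z in M. z \<notin> B'"
      using c
    proof eventually_elim
      case (elim z)
      then show ?case using small[of z] by (auto simp: not_le)
    qed
    moreover have "B' \<in> sets M" using y by (simp add: B'_def)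
    ultimately have "emeasure M B' = 0" by (simp add: AE_iff_null_sets null_setsD1)
    then show False using pos by (simp add: measure_def)
  qed
qed

end

section \<open>From the Muckenhoupt condition to porosity and doubling holes\<close>

context homogeneous_space_subset
begin

lemma A1_constant:
  assumes "w \<alpha> \<in> A1_class X d M"
  obtains C where "0 < C" "\<And>x r. x \<in> X \<Longrightarrow> 0 < r \<Longrightarrow>
    set_nn_integral M (B x r) (w \<alpha>) \<le> ennreal C * ess_inf_on M (B x r) (w \<alpha>) * ennreal (measure M (B x r))"
proof -
  obtain C where C: "0 < C" "\<And>x r. x \<in> X \<Longrightarrow> 0 < r \<Longrightarrow>
    set_nn_integral M (B x r) (w \<alpha>) / emeasure M (B x r) \<le> ennreal C * ess_inf_on M (B x r) (w \<alpha>)"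
    using assms unfolding A1_class_def by blast
  have "set_nn_integral M (B x r) (w \<alpha>) \<le>
    ennreal C * ess_inf_on M (B x r) (w \<alpha>) * ennreal (measure M (B x r))" if "x \<in> X" "0 < r" for x r
  proof -
    have "0 < measure M (B x r)" using measure_ball_pos that .
    then have "set_nn_integral M (B x r) (w \<alpha>) =
        set_nn_integral M (B x r) (w \<alpha>) / ennreal (measure M (B x r)) * ennreal (measure M (B x r))"
      by (simp add: ennreal_divide_times)
    also have "\<dots> \<le> ennreal C * ess_inf_on M (B x r) (w \<alpha>) * ennreal (measure M (B x r))"
      using C(2)[OF that] ball_fmeasurable[OF that(1)]
      by (intro mult_right_mono) (auto simp: emeasure_eq_measure2)
    finally show ?thesis .
  qed
  then show ?thesis using C(1) that by blast
qed

text \<open>The average of the weight over the large ball is controlled by its values on a hole of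
  radius \<open>s\<close>, hence by a multiple of \<open>s powr - \<alpha>\<close>. By Chebyshev's inequality the weight cannot be
  much larger than that on more than half of the small ball.\<close>

lemma A1_imp_dist_large:
  assumes "w \<alpha> \<in> A1_class X d M" "0 < \<alpha>"
  obtains c where "0 < c"
    "\<And>x r r' s. \<lbrakk>x \<in> X; 0 < r; r \<le> r'; r' \<le> L * r; s \<in> hole_radii X d E x r'\<rbrakk> \<Longrightarrow>
      measure M (B x r) \<le> 2 * measure M (B x r - near (c * s))"
proof -
  obtain C where C: "0 < C" "\<And>x r. x \<in> X \<Longrightarrow> 0 < r \<Longrightarrow>
    set_nn_integral M (B x r) (w \<alpha>) \<le> ennreal C * ess_inf_on M (B x r) (w \<alpha>) * ennreal (measure M (B x r))"
    using A1_constant[OF assms(1)] by blast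
  obtain D where D: "1 \<le> D"
    "\<And>x r. x \<in> X \<Longrightarrow> 0 < r \<Longrightarrow> measure M (B x (L * r)) \<le> D * measure M (B x r)"
    using measure_doubling by blast
  \<comment> \<open>Chosen such that the bound in Chebyshev's inequality is exactly half of the measure.\<close>
  define q where "q = (1 / (2 * C * D)) powr (1 / \<alpha>)"
  define c where "c = q / (2 * K)"
  have q: "0 < q" "q powr \<alpha> = 1 / (2 * C * D)"
    using C(1) D(1) assms(2) by (auto simp: q_def powr_powr)
  have c: "0 < c" using q K_pos by (simp add: c_def)
  have "measure M (B x r) \<le> 2 * measure M (B x r - near (c * s))"
    if x: "x \<in> X" and r: "0 < r" "r \<le> r'" "r' \<le> L * r" and s: "s \<in> hole_radii X d E x r'" for x r r' s
  proof -
    have s_pos: "0 < s" using s by (simp add: hole_radii_def)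
    define N where "N = B x r \<inter> near (c * s)"
    have N: "N \<in> fmeasurable M"
      unfolding N_def using x ball_fmeasurable near_measurable by (intro fmeasurable_Int_fmeasurable)
    define u where "u = (c * s) powr - \<alpha>"
    have u: "0 < u" using c s_pos by (simp add: u_def)
    have "s / (2 * K) = c * s / q" using q K_pos by (simp add: c_def field_simps)
    moreover have "(a / q) powr - \<alpha> = a powr - \<alpha> * q powr \<alpha>" if "0 \<le> a" for a
      using that q(1) by (simp add: powr_divide powr_minus_divide)
    ultimately have "(s / (2 * K)) powr - \<alpha> = u * q powr \<alpha>"
      using c s_pos unfolding u_def by simp
    define b where "b = u / (2 * C * D)"
    have b: "0 < b" "C * D * b = u / 2" using u C(1) D(1) by (auto simp: b_def)
    have v: "(s / (2 * K)) powr - \<alpha> = b"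
      using \<open>(s / (2 * K)) powr - \<alpha> = u * q powr \<alpha>\<close> q by (simp add: b_def)
    have "ennreal (u * measure M N) = (\<integral>\<^sup>+z. ennreal u * indicator N z \<partial>M)"
      using N u by (subst nn_integral_cmult_indicator) (auto simp: emeasure_eq_measure2 ennreal_mult)
    also have "\<dots> \<le> set_nn_integral M (B x r') (w \<alpha>)"
    proof (rule nn_integral_mono)
      fix z
      show "ennreal u * indicator N z \<le> w \<alpha> z * indicator (B x r') z"
      proof (cases "z \<in> N")
        case True
        then have "z \<in> B x r'" "z \<in> X" "\<delta> z \<le> c * s"
          using r ball_mono[of r r' x] by (auto simp: N_def near_def)
        then show ?thesis using w_ge[of z "c * s" \<alpha>] assms by (simp add: u_def True)
      qed simp
    qed
    also have "\<dots> \<le> ennreal C * ess_inf_on M (B x r') (w \<alpha>) * ennreal (measure M (B x r'))"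
      using C(2) x r by auto
    also have "\<dots> \<le> ennreal C * ennreal b * ennreal (measure M (B x r'))"
      using ess_inf_le_hole[OF x s assms(2)] by (intro mult_right_mono mult_left_mono) (auto simp: v)
    also have "\<dots> = ennreal (C * b * measure M (B x r'))"
      using C(1) b by (simp add: ennreal_mult)
    finally have "u * measure M N \<le> C * b * measure M (B x r')"
      using C(1) b by (subst (asm) ennreal_le_iff) auto
    also have "\<dots> \<le> C * b * (D * measure M (B x r))"
    proof (intro mult_left_mono)
      have "measure M (B x r') \<le> measure M (B x (L * r))"
        using r x by (intro measure_mono_fmeasurable ball_mono) (auto simp: ball_fmeasurable)
      also have "\<dots> \<le> D * measure M (B x r)" using D x r by blast
      finally show "measure M (B x r') \<le> D * measure M (B x r)" .
    qed (use C(1) b in auto)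
    also have "\<dots> = u * (measure M (B x r) / 2)" using b(2) by (simp add: mult_ac)
    finally have "measure M N \<le> measure M (B x r) / 2" using u by simp
    moreover have "measure M (B x r - near (c * s)) = measure M (B x r) - measure M N"
    proof -
      have "B x r - near (c * s) = B x r - N" by (auto simp: N_def)
      then show ?thesis using N ball_fmeasurable[OF x]
        by (simp add: measurable_measure_Diff fmeasurableD N_def)
    qed
    ultimately show ?thesis by simp
  qed
  then show ?thesis using c that by blast
qed

text \<open>A hole of radius \<open>s\<close> in the double ball forces a point with distance at least a multiple of
  \<open>s\<close> to \<open>E\<close> in the middle of the given ball, hence a hole of comparable radius there.\<close>

lemma A1_imp_hole_doubling:
  assumes "w \<alpha> \<in> A1_class X d M" "0 < \<alpha>"
  shows "hole_doubling X d E"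
proof -
  obtain c where c: "0 < c"
    "\<And>x r r' s. \<lbrakk>x \<in> X; 0 < r; r \<le> r'; r' \<le> 4 * K * r; s \<in> hole_radii X d E x r'\<rbrakk> \<Longrightarrow>
      measure M (B x r) \<le> 2 * measure M (B x r - near (c * s))"
    using A1_imp_dist_large[OF assms] by blast
  \<comment> \<open>A hole radius \<open>s\<close> of \<open>B x (2 * r)\<close> is at most \<open>4 * K * r\<close>, so \<open>m * s\<close> is at most \<open>r / (2 * K)\<close>.\<close>
  define m where "m = min c (1 / (8 * K\<^sup>2))"
  have m: "0 < m" "m \<le> c" "m \<le> 1 / (8 * K\<^sup>2)" using c(1) K_pos by (auto simp: m_def)
  have "h x (2 * r) \<le> 1 / m * h x r" if x: "x \<in> X" and r: "0 < r" for x r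
  proof (rule hole_fun_leI)
    fix s assume s: "s \<in> hole_radii X d E x (2 * r)"
    then have s': "0 < s" "s \<le> 4 * K * r" by (auto simp: hole_radii_def)
    define r0 where "r0 = r / (2 * K)"
    have r0: "0 < r0" "r = 2 * K * r0" using r K_pos by (auto simp: r0_def)
    have "r0 * 1 \<le> r0 * (4 * K)" using r0 K_ge_1 by (intro mult_left_mono) auto
    then have "measure M (B x r0) \<le> 2 * measure M (B x r0 - near (c * s))"
      using x r0 s by (intro c(2)[of x r0 "2 * r"]) auto
    moreover have "0 < measure M (B x r0)" using measure_ball_pos x r0 by blast
    ultimately have "measure M (B x r0 - near (c * s)) \<noteq> 0" by linarith
    then have "B x r0 - near (c * s) \<noteq> {}" by (metis measure_empty)
    then obtain y where y: "y \<in> B x r0" "y \<notin> near (c * s)" by auto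
    then have dy: "c * s \<le> \<delta> y" by (auto simp: near_def qball_def)
    have "m * s \<le> c * s" using m s' by (intro mult_right_mono) auto
    moreover have "m * s \<le> r0"
    proof -
      have "m * s \<le> 1 / (8 * K\<^sup>2) * (4 * K * r)" using m s' by (intro mult_mono) auto
      also have "\<dots> = r0" using K_pos by (simp add: r0_def power2_eq_square)
      finally show ?thesis .
    qed
    ultimately have "m * s \<le> min (\<delta> y) r0" using dy by simp
    also have "\<dots> \<le> h x r" using hole_fun_ge_min_dist[of x r y] x r y by (simp add: r0_def)
    finally show "s \<le> 1 / m * h x r" using m by (simp add: field_simps)
  qed (use m hole_fun_nonneg in simp)
  then show ?thesis using m(1) unfolding hole_doubling_def by (intro exI[of _ "1 / m"]) simp
qed

text \<open>Otherwise the weight would be infinite on a smaller ball and could not be locally integrable.\<close>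

lemma weight_imp_hole:
  assumes "weight X d M (w \<alpha>)" "x \<in> X" "0 < r"
  shows "0 < h x r"
proof -
  define r0 where "r0 = r / (2 * K)"
  have r0: "0 < r0" using assms K_pos by (simp add: r0_def)
  have "\<exists>y\<in>B x r0. \<delta> y \<noteq> 0"
  proof (rule ccontr)
    assume "\<not> ?thesis"
    then have "set_nn_integral M (B x r0) (w \<alpha>) = (\<integral>\<^sup>+z. \<infinity> * indicator (B x r0) z \<partial>M)"
      by (intro nn_integral_cong) (auto simp: dist_power_weight_def split: split_indicator)
    also have "\<dots> = \<infinity> * emeasure M (B x r0)" using assms by (intro nn_integral_cmult_indicator) simp
    also have "\<dots> = \<infinity>" using measure_ball_pos[of x r0] ball_fmeasurable[of x r0] assms r0
      by (simp add: emeasure_eq_measure2 ennreal_top_mult)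
    finally show False using assms r0 unfolding weight_def by fastforce
  qed
  then obtain y where y: "y \<in> B x r0" "\<delta> y \<noteq> 0" by auto
  then have "0 < \<delta> y" using dist_nonneg[of y] by (auto simp: qball_def)
  then have "0 < min (\<delta> y) r0" using r0 by simp
  also have "\<dots> \<le> h x r" using hole_fun_ge_min_dist[of x r y] assms y by (simp add: r0_def)
  finally show ?thesis .
qed

text \<open>The points of the smaller ball far from \<open>E\<close> make up half of its measure. All balls of the one
  radius \<open>\<gamma> * h x r\<close> around them are holes, and a finite disjoint subfamily has comparable measure.\<close>

lemma A1_imp_weakly_porous:
  assumes "w \<alpha> \<in> A1_class X d M" "0 < \<alpha>"
  shows "weakly_porous X d M E"
proof -
  obtain c where c: "0 < c"
    "\<And>x r r' s. \<lbrakk>x \<in> X; 0 < r; r \<le> r'; r' \<le> 2 * K * r; s \<in> hole_radii X d E x r'\<rbrakk> \<Longrightarrow>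
      measure M (B x r) \<le> 2 * measure M (B x r - near (c * s))"
    using A1_imp_dist_large[OF assms] by blast
  obtain C where C: "1 \<le> C"
    "\<And>S f R x r. \<lbrakk>S \<in> sets M; x \<in> X; \<And>y. y \<in> S \<Longrightarrow> 0 < f y \<and> f y \<le> R \<and> B y (f y) \<subseteq> B x r\<rbrakk> \<Longrightarrow>
      \<exists>J\<subseteq>S. finite J \<and> disjoint_family_on (\<lambda>y. B y (f y)) J \<and>
        measure M S \<le> C * (\<Sum>y\<in>J. measure M (B y (f y)))"
    using finite_vitali by blast
  obtain D where D: "1 \<le> D"
    "\<And>x r. x \<in> X \<Longrightarrow> 0 < r \<Longrightarrow> measure M (B x (2 * K * r)) \<le> D * measure M (B x r)"
    using measure_doubling by blast
  \<comment> \<open>The factor \<open>c / 2\<close> because the hole \<open>s\<close> used below only has \<open>s > h x r / 2\<close>; the other bound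
    ensures \<open>\<gamma> * h x r \<le> r / (2 * K)\<close> by \<open>h x r \<le> 2 * K * r\<close>.\<close>
  define \<gamma> where "\<gamma> = min (c / 2) (1 / (4 * K\<^sup>2))"
  define \<sigma> where "\<sigma> = 1 / (2 * C * D)"
  have K2: "1 \<le> K\<^sup>2" using K_ge_1 by (simp add: one_le_power)
  then have "1 / (4 * K\<^sup>2) < 1" by (simp add: divide_less_eq)
  then have "\<gamma> < 1" unfolding \<gamma>_def by (rule le_less_trans[OF min.cobounded2])
  moreover have "0 < \<gamma>" "\<gamma> \<le> c / 2" "\<gamma> \<le> 1 / (4 * K\<^sup>2)"
    using c(1) K_pos by (auto simp: \<gamma>_def)
  ultimately have \<gamma>: "0 < \<gamma>" "\<gamma> < 1" "\<gamma> \<le> c / 2" "\<gamma> \<le> 1 / (4 * K\<^sup>2)" by blast+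
  have CD: "1 \<le> C * D" using C(1) D(1) mult_mono[of 1 C 1 D] by simp
  then have \<sigma>: "0 < \<sigma>" "\<sigma> < 1" using C(1) D(1) by (auto simp: \<sigma>_def divide_less_eq)
  have "\<exists>(N::nat) (c::nat \<Rightarrow> 'a) (\<rho>::nat \<Rightarrow> real).
        (\<forall>i\<in>{1..N}. c i \<in> X \<and> 0 < \<rho> i) \<and>
        disjoint_family_on (\<lambda>i. B (c i) (\<rho> i)) {1..N} \<and>
        (\<forall>i\<in>{1..N}. B (c i) (\<rho> i) \<subseteq> B x r - E) \<and>
        (\<forall>i\<in>{1..N}. \<rho> i \<ge> \<gamma> * h x r) \<and>
        (\<forall>i\<in>{1..N}. \<rho> i \<le> 2 * K * r) \<and>
        (\<Sum>i=1..N. emeasure M (B (c i) (\<rho> i))) \<ge> ennreal \<sigma> * emeasure M (B x r)"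
    if x: "x \<in> X" and r: "0 < r" for x r
  proof -
    have h_pos: "0 < h x r" using assms x r by (intro weight_imp_hole) (auto simp: A1_class_def)
    define a where "a = \<gamma> * h x r"
    have "0 < a" using h_pos \<gamma> by (simp add: a_def)
    obtain s where s: "s \<in> hole_radii X d E x r" "h x r / 2 < s"
      using hole_fun_approx[of "h x r / 2" x r] h_pos by auto
    define r0 where "r0 = r / (2 * K)"
    have r0: "0 < r0" "r = 2 * K * r0" using r K_pos by (auto simp: r0_def)
    have "r0 * 1 \<le> r0 * (2 * K)" using r0 K_ge_1 by (intro mult_left_mono) auto
    then have r0_le: "r0 \<le> r" using r0 by (simp add: mult_ac)
    define F where "F = B x r0 - near (c * s)"
    have F: "measure M (B x r0) \<le> 2 * measure M F"
      unfolding F_def using x r0 r0_le s by (intro c(2)[of x r0 r]) auto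
    have a_le: "a \<le> r0"
    proof -
      have "a \<le> 1 / (4 * K\<^sup>2) * (2 * K * r)"
        unfolding a_def using \<gamma> hole_fun_le[OF r] hole_fun_nonneg by (intro mult_mono) auto
      also have "\<dots> = r0" using K_pos by (simp add: r0_def power2_eq_square)
      finally show ?thesis .
    qed
    have a_sub: "B y a \<subseteq> B x r - E" if "y \<in> F" for y
    proof (rule hole_radii_from_dist(1)[OF x r])
      show "y \<in> B x (r / (2 * K))" using that by (simp add: F_def r0_def)
      have "a \<le> c / 2 * h x r" unfolding a_def using \<gamma> h_pos by (intro mult_right_mono) auto
      also have "\<dots> \<le> c * s" using s c(1) by simp
      also have "\<dots> \<le> \<delta> y" using that by (auto simp: F_def near_def qball_def)
      finally show "a \<le> \<delta> y" .
    qed (use \<open>0 < a\<close> a_le r0_def in auto)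
    have "F \<in> sets M" using x near_measurable by (simp add: F_def)
    then obtain J where J: "J \<subseteq> F" "finite J" "disjoint_family_on (\<lambda>y. B y a) J"
      "measure M F \<le> C * (\<Sum>y\<in>J. measure M (B y a))"
      using C(2)[of F x "\<lambda>_. a" a r] a_sub x \<open>0 < a\<close> by auto
    have JX: "J \<subseteq> X" using J(1) ball_subset_space by (auto simp: F_def)
    obtain g where g: "bij_betw g {1..card J} J" using ex_bij_betw_nat_finite_1[OF J(2)] by blast
    have gJ: "g i \<in> J" if "i \<in> {1..card J}" for i using bij_betwE[OF g] that by blast
    have "measure M (B x r) \<le> D * measure M (B x r0)" using D(2)[OF x r0(1)] r0 by simp
    also have "\<dots> \<le> D * (2 * (C * (\<Sum>y\<in>J. measure M (B y a))))"
      using F J(4) D(1) by (intro mult_left_mono) auto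
    finally have "\<sigma> * measure M (B x r) \<le> (\<Sum>y\<in>J. measure M (B y a))"
      using C(1) D(1) by (simp add: \<sigma>_def divide_le_eq mult_ac)
    then have "ennreal \<sigma> * emeasure M (B x r) \<le> ennreal (\<Sum>y\<in>J. measure M (B y a))"
      using x \<sigma> by (simp add: ball_fmeasurable emeasure_eq_measure2 ennreal_mult[symmetric] ennreal_leI)
    also have "\<dots> = (\<Sum>y\<in>J. emeasure M (B y a))"
    proof -
      have "(\<Sum>y\<in>J. emeasure M (B y a)) = (\<Sum>y\<in>J. ennreal (measure M (B y a)))"
        using JX by (intro sum.cong) (auto simp: emeasure_eq_measure2 ball_fmeasurable)
      then show ?thesis by (simp add: sum_ennreal)
    qed
    also have "\<dots> = (\<Sum>i=1..card J. emeasure M (B (g i) a))"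
      using sum.reindex_bij_betw[OF g, of "\<lambda>y. emeasure M (B y a)"] by simp
    finally have sum: "ennreal \<sigma> * emeasure M (B x r) \<le> (\<Sum>i=1..card J. emeasure M (B (g i) a))" .
    have disj: "disjoint_family_on (\<lambda>i. B (g i) a) {1..card J}"
      unfolding disjoint_family_on_def
    proof (intro ballI impI)
      fix i j assume ij: "i \<in> {1..card J}" "j \<in> {1..card J}" "i \<noteq> j"
      then have "g i \<noteq> g j" using inj_onD[OF bij_betw_imp_inj_on[OF g]] by metis
      then show "B (g i) a \<inter> B (g j) a = {}"
        using J(3) gJ ij unfolding disjoint_family_on_def by blast
    qed
    have "a \<le> 2 * K * r" using a_le r0_le K_ge_1 mult_mono[of 1 "2 * K" r r] r by linarith
    moreover have "\<forall>i\<in>{1..card J}. g i \<in> X \<and> 0 < a" "\<forall>i\<in>{1..card J}. B (g i) a \<subseteq> B x r - E"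
      using gJ J(1) JX a_sub \<open>0 < a\<close> by blast+
    ultimately show ?thesis
      using disj sum
      by (intro exI[of _ "card J"] exI[of _ g] exI[of _ "\<lambda>_. a"] conjI) (simp_all add: a_def)
  qed
  then have "weakly_porous_with X d M E \<sigma> \<gamma>"
    unfolding weakly_porous_with_def using E_subset E_nonempty by blast
  then show ?thesis
    unfolding weakly_porous_def using \<gamma> \<sigma> by (meson greaterThanLessThan_iff)
qed

end

section \<open>Balls adapted to the size of their holes\<close>

context quasi_space_subset
begin

lemma hole_fun_doubling_pow:
  assumes "1 \<le> H" "\<And>x r. x \<in> X \<Longrightarrow> 0 < r \<Longrightarrow> h x (2 * r) \<le> H * h x r" "x \<in> X" "0 < r"
  shows "h x (2 ^ n * r) \<le> H ^ n * h x r"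
proof (induction n)
  case (Suc n)
  have "h x (2 ^ Suc n * r) \<le> H * h x (2 ^ n * r)"
    using assms(2)[of x "2 ^ n * r"] assms(3,4) by (simp add: mult_ac)
  also have "\<dots> \<le> H * (H ^ n * h x r)"
    using Suc assms(1) by (intro mult_left_mono) auto
  finally show ?case by (simp add: mult_ac)
qed auto

lemma hole_doubling_constant:
  assumes "hole_doubling X d E"
  obtains H where "1 < H" "\<And>x r. x \<in> X \<Longrightarrow> 0 < r \<Longrightarrow> h x (2 * r) \<le> H * h x r"
proof -
  obtain C where C: "\<And>x r. x \<in> X \<Longrightarrow> 0 < r \<Longrightarrow> h x (2 * r) \<le> C * h x r"
    using assms unfolding hole_doubling_def by blast
  have "h x (2 * r) \<le> max 2 C * h x r" if "x \<in> X" "0 < r" for x r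
  proof -
    have "C * h x r \<le> max 2 C * h x r" using hole_fun_nonneg by (intro mult_right_mono) auto
    with C[OF that] show ?thesis by linarith
  qed
  then show ?thesis by (intro that[of "max 2 C"]) auto
qed

lemma hole_fun_doubling:
  assumes "hole_doubling X d E"
  obtains H where "1 \<le> H" "\<And>x r. x \<in> X \<Longrightarrow> 0 < r \<Longrightarrow> h x (c * r) \<le> H * h x r"
proof -
  obtain H where H: "1 < H" "\<And>x r. x \<in> X \<Longrightarrow> 0 < r \<Longrightarrow> h x (2 * r) \<le> H * h x r"
    using hole_doubling_constant[OF assms] by blast
  obtain n where n: "c < 2 ^ n" using real_arch_pow[of 2 c] by auto
  have "h x (c * r) \<le> H ^ n * h x r" if "x \<in> X" "0 < r" for x r
  proof -
    have "c * r \<le> 2 ^ n * r" using that n by (intro mult_right_mono) auto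
    then have "h x (c * r) \<le> h x (2 ^ n * r)" by (intro hole_fun_mono ball_mono)
    also have "\<dots> \<le> H ^ n * h x r" using hole_fun_doubling_pow[of H] H that by simp
    finally show ?thesis .
  qed
  then show ?thesis using H(1) by (intro that[of "H ^ n"]) auto
qed

text \<open>A point of the ball at large distance from \<open>E\<close> creates a hole of the ball with radius
  enlarged by the factor \<open>2 K\<close>; doubling carries this hole back to the original ball.\<close>

lemma dist_le_hole_fun:
  assumes "hole_doubling X d E" "0 \<le> a"
  obtains L where "1 \<le> L"
    "\<And>x r z. \<lbrakk>x \<in> X; 0 < r; \<delta> x \<le> a * r; z \<in> B x r\<rbrakk> \<Longrightarrow> \<delta> z \<le> L * h x r"
proof -
  obtain H where H: "1 \<le> H" "\<And>x r. x \<in> X \<Longrightarrow> 0 < r \<Longrightarrow> h x (2 * K * r) \<le> H * h x r"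
    using hole_fun_doubling[OF assms(1)] by blast
  define b where "b = K * (1 + a)"
  have b: "1 \<le> b" using K_ge_1 assms(2) mult_mono[of 1 K 1 "1 + a"] by (simp add: b_def)
  have far: "\<delta> z \<le> b * H * h x r" if x: "x \<in> X" and r: "0 < r" "\<delta> x \<le> a * r" and z: "z \<in> B x r" for x r z
  proof -
    have zX: "z \<in> X" "d z x < r" using z x by (auto simp: qball_def d_commute)
    have "\<delta> z \<le> K * (d z x + \<delta> x)" using dist_quasi_Lipschitz x zX by blast
    also have "\<dots> \<le> K * (r + a * r)" using zX r K_pos by (intro mult_left_mono) auto
    also have "\<dots> = b * r" by (simp add: b_def algebra_simps)
    finally have "\<delta> z \<le> b * r" .
    moreover have "\<delta> z \<le> b * \<delta> z" using mult_right_mono[OF b dist_nonneg[OF zX(1)]] by simp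
    ultimately have "\<delta> z \<le> b * min (\<delta> z) r" by (simp add: min_def)
    also have "min (\<delta> z) r \<le> h x (2 * K * r)"
      using hole_fun_ge_min_dist[of x "2 * K * r" z] x r z K_pos by simp
    also have "\<dots> \<le> H * h x r" using H(2) x r by blast
    finally show ?thesis using b by (simp add: mult_ac)
  qed
  have "1 \<le> b * H" using b H(1) mult_mono[of 1 b 1 H] by simp
  then show ?thesis by (rule that[of "b * H"]) (fact far)
qed

text \<open>The radius is halved until the maximal hole has radius at most \<open>t\<close>. By doubling, the last
  halving reduced the hole function by at most the factor \<open>H\<close>.\<close>

lemma stopping_radius:
  assumes H: "1 \<le> H" "\<And>x r. x \<in> X \<Longrightarrow> 0 < r \<Longrightarrow> h x (2 * r) \<le> H * h x r"
    and y: "y \<in> X" "0 < R" and t: "0 < t" "t < h y R"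
  obtains n where "h y (R / 2 ^ n) \<le> t" "t < H * h y (R / 2 ^ n)" "h y R \<le> H ^ n * t"
proof -
  define P where "P n \<longleftrightarrow> h y (R / 2 ^ n) \<le> t" for n :: nat
  obtain n0 where "2 * K * R / t < 2 ^ n0" using real_arch_pow[of 2 "2 * K * R / t"] by auto
  then have "2 * K * (R / 2 ^ n0) \<le> t" using t by (simp add: field_simps)
  moreover have "h y (R / 2 ^ n0) \<le> 2 * K * (R / 2 ^ n0)" using y by (intro hole_fun_le) simp
  ultimately have "P n0" by (simp add: P_def)
  define n where "n = (LEAST n. P n)"
  have Pn: "P n" unfolding n_def using \<open>P n0\<close> by (rule LeastI)
  moreover have "\<not> P 0" using t by (simp add: P_def)
  ultimately obtain m where m: "n = Suc m" by (cases n) auto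
  then have "\<not> P m" using not_less_Least[of m P] by (simp add: n_def)
  then have "t < h y (2 * (R / 2 ^ n))" by (simp add: P_def m)
  also have "\<dots> \<le> H * h y (R / 2 ^ n)" using y by (intro H(2)) auto
  finally have "t < H * h y (R / 2 ^ n)" .
  moreover have "h y R \<le> H ^ n * t"
  proof -
    have "h y (2 ^ n * (R / 2 ^ n)) \<le> H ^ n * h y (R / 2 ^ n)"
      using y by (intro hole_fun_doubling_pow[OF H]) auto
    also have "\<dots> \<le> H ^ n * t" using Pn H(1) unfolding P_def by (intro mult_left_mono) auto
    finally show ?thesis by simp
  qed
  ultimately show ?thesis using that Pn by (simp add: P_def)
qed

end

context homogeneous_space_subset
begin

text \<open>Shrinking the porosity holes by the factor \<open>2 K\<close> keeps a fixed fraction of their measure and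
  moves them away from \<open>E\<close>. Since the holes have positive total measure, at least one of them
  exists, so that \<open>h\<close> is positive.\<close>

lemma weakly_porous_dist_large:
  assumes "weakly_porous X d M E"
  obtains Q \<gamma> where "0 < Q" "0 < \<gamma>" "\<And>x r. x \<in> X \<Longrightarrow> 0 < r \<Longrightarrow> 0 < h x r"
    "\<And>x r. x \<in> X \<Longrightarrow> 0 < r \<Longrightarrow> measure M (B x r) \<le> Q * measure M (B x r - near (\<gamma> * h x r))"
proof -
  obtain \<sigma> \<gamma> where \<sigma>: "0 < \<sigma>" "0 < \<gamma>" and porous: "weakly_porous_with X d M E \<sigma> \<gamma>"
    using assms unfolding weakly_porous_def by auto
  obtain D where D: "1 \<le> D"
    "\<And>x r. x \<in> X \<Longrightarrow> 0 < r \<Longrightarrow> measure M (B x (2 * K * r)) \<le> D * measure M (B x r)"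
    using measure_doubling by blast
  have "0 < h x r \<and> measure M (B x r) \<le> D / \<sigma> * measure M (B x r - near (\<gamma> / (2 * K) * h x r))"
    if x: "x \<in> X" and r: "0 < r" for x r
  proof -
    obtain N :: nat and c and \<rho> :: "nat \<Rightarrow> real" where
      c: "\<forall>i\<in>{1..N}. c i \<in> X \<and> 0 < \<rho> i" and
      disj: "disjoint_family_on (\<lambda>i. B (c i) (\<rho> i)) {1..N}" and
      sub: "\<forall>i\<in>{1..N}. B (c i) (\<rho> i) \<subseteq> B x r - E" and
      large: "\<forall>i\<in>{1..N}. \<rho> i \<ge> \<gamma> * h x r" and
      small: "\<forall>i\<in>{1..N}. \<rho> i \<le> 2 * K * r" and
      sum: "(\<Sum>i=1..N. emeasure M (B (c i) (\<rho> i))) \<ge> ennreal \<sigma> * emeasure M (B x r)"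
      using porous[unfolded weakly_porous_with_def, THEN conjunct2, THEN conjunct2, rule_format, OF x r]
      by (elim exE conjE)
    have "(\<Sum>i=1..N. emeasure M (B (c i) (\<rho> i))) = ennreal (\<Sum>i=1..N. measure M (B (c i) (\<rho> i)))"
      using c by (subst sum_ennreal[symmetric]) (auto intro!: sum.cong simp: emeasure_eq_measure2 ball_fmeasurable)
    moreover have "ennreal \<sigma> * emeasure M (B x r) = ennreal (\<sigma> * measure M (B x r))"
      using x \<sigma> by (simp add: emeasure_eq_measure2 ball_fmeasurable ennreal_mult)
    ultimately have sum': "\<sigma> * measure M (B x r) \<le> (\<Sum>i=1..N. measure M (B (c i) (\<rho> i)))"
      using sum by (simp add: sum_nonneg)
    have pos: "0 < \<sigma> * measure M (B x r)" using \<sigma> measure_ball_pos x r by simp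
    have "N \<noteq> 0"
    proof
      assume "N = 0" with sum' pos show False by simp
    qed
    then have "1 \<in> {1..N}" by simp
    then have "\<rho> 1 \<in> hole_radii X d E x r" "0 < \<rho> 1"
      using c sub small unfolding mem_hole_radii_iff by blast+
    then have "0 < h x r" using hole_fun_ge[of "\<rho> 1" x r] by simp
    define S where "S i = B (c i) (\<rho> i / (2 * K))" for i
    have S_sub: "S i \<subseteq> B (c i) (\<rho> i)" if "i \<in> {1..N}" for i
      unfolding S_def using c that by (intro shrunk_ball_subset) auto
    have S_meas: "S i \<in> fmeasurable M" if "i \<in> {1..N}" for i
      unfolding S_def using c that by (intro ball_fmeasurable) auto
    have S_far: "S i \<subseteq> B x r - near (\<gamma> / (2 * K) * h x r)" if i: "i \<in> {1..N}" for i
    proof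
      fix z assume z: "z \<in> S i"
      have "B (c i) (\<rho> i) \<inter> E = {}" using sub i by blast
      then have "\<rho> i / (2 * K) \<le> \<delta> z" using c i z by (intro dist_in_hole) (auto simp: S_def)
      moreover have "\<gamma> / (2 * K) * h x r \<le> \<rho> i / (2 * K)"
        using large i K_pos by (simp add: field_simps)
      ultimately have "z \<notin> near (\<gamma> / (2 * K) * h x r)" by (auto simp: near_def)
      then show "z \<in> B x r - near (\<gamma> / (2 * K) * h x r)" using S_sub[OF i] sub i z by blast
    qed
    have "\<sigma> * measure M (B x r) \<le> (\<Sum>i=1..N. measure M (B (c i) (\<rho> i)))" by (fact sum')
    also have "\<dots> \<le> (\<Sum>i=1..N. D * measure M (S i))"
    proof (rule sum_mono)
      fix i assume "i \<in> {1..N}"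
      then show "measure M (B (c i) (\<rho> i)) \<le> D * measure M (S i)"
        using D(2)[of "c i" "\<rho> i / (2 * K)"] c K_pos by (auto simp: S_def)
    qed
    also have "\<dots> = D * measure M (\<Union>i\<in>{1..N}. S i)"
      using measure_UN_disjoint_family[OF _ disj S_sub S_meas] by (simp add: sum_distrib_left)
    also have "\<dots> \<le> D * measure M (B x r - near (\<gamma> / (2 * K) * h x r))"
    proof (intro mult_left_mono measure_mono_fmeasurable)
      show "(\<Union>i\<in>{1..N}. S i) \<subseteq> B x r - near (\<gamma> / (2 * K) * h x r)" using S_far by blast
      show "(\<Union>i\<in>{1..N}. S i) \<in> sets M" using S_meas by auto
      show "B x r - near (\<gamma> / (2 * K) * h x r) \<in> fmeasurable M"
        using ball_fmeasurable[OF x] near_measurable by (rule fmeasurable_Diff)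
    qed (use D in auto)
    finally show ?thesis using \<open>0 < h x r\<close> \<sigma> by (simp add: field_simps)
  qed
  note large = this
  show ?thesis
  proof (rule that[of "D / \<sigma>" "\<gamma> / (2 * K)"])
    show "0 < D / \<sigma>" "0 < \<gamma> / (2 * K)" using D(1) \<sigma> K_pos by auto
  qed (use large in blast)+
qed

text \<open>Around a point at distance less than \<open>t\<close> from \<open>E\<close>, the ball whose maximal hole has
  radius about \<open>t\<close> lies in a neighbourhood of \<open>E\<close> of width comparable with \<open>t\<close>, while weak porosity
  keeps a fixed fraction of it outside a narrower neighbourhood. The radius of this ball is
  controlled through the number \<open>n\<close> of halvings.\<close>

lemma ball_in_annulus:
  assumes "weakly_porous X d M E" "hole_doubling X d E"
  obtains H Q l L where "1 < H" "0 < Q" "0 < l" "1 \<le> L"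
    "\<And>x r. x \<in> X \<Longrightarrow> 0 < r \<Longrightarrow> 0 < h x r"
    "\<And>y R t. \<lbrakk>y \<in> X; 0 < R; 0 < t; t < h y R; \<delta> y < t\<rbrakk> \<Longrightarrow>
      \<exists>n. h y R \<le> H ^ n * t \<and> B y (R / 2 ^ n) \<subseteq> near (L * t) \<and>
        measure M (B y (R / 2 ^ n)) \<le> Q * measure M (B y (R / 2 ^ n) - near (l * t))"
proof -
  obtain H where H: "1 < H" "\<And>x r. x \<in> X \<Longrightarrow> 0 < r \<Longrightarrow> h x (2 * r) \<le> H * h x r"
    using hole_doubling_constant[OF assms(2)] by blast
  obtain Q \<gamma> where Q: "0 < Q" "0 < \<gamma>" "\<And>x r. x \<in> X \<Longrightarrow> 0 < r \<Longrightarrow> 0 < h x r"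
    "\<And>x r. x \<in> X \<Longrightarrow> 0 < r \<Longrightarrow> measure M (B x r) \<le> Q * measure M (B x r - near (\<gamma> * h x r))"
    using weakly_porous_dist_large[OF assms(1)] by blast
  \<comment> \<open>At the stopping radius \<open>s\<close> one has \<open>\<delta> y < t < H * h y s \<le> H * (2 * K) * s\<close>.\<close>
  have "0 \<le> H * (2 * K)" using H(1) K_pos by simp
  then obtain L where L: "1 \<le> L"
    "\<And>x r z. \<lbrakk>x \<in> X; 0 < r; \<delta> x \<le> H * (2 * K) * r; z \<in> B x r\<rbrakk> \<Longrightarrow> \<delta> z \<le> L * h x r"
    using dist_le_hole_fun[OF assms(2)] by blast
  have annulus: "\<exists>n. h y R \<le> H ^ n * t \<and> B y (R / 2 ^ n) \<subseteq> near (2 * L * t) \<and>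
        measure M (B y (R / 2 ^ n)) \<le> Q * measure M (B y (R / 2 ^ n) - near (\<gamma> / H * t))"
    if y: "y \<in> X" "0 < R" and t: "0 < t" "t < h y R" and near: "\<delta> y < t" for y R t
  proof -
    obtain n where n: "h y (R / 2 ^ n) \<le> t" "t < H * h y (R / 2 ^ n)" "h y R \<le> H ^ n * t"
      using stopping_radius[OF _ H(2) y t] H(1) by auto
    define s where "s = R / 2 ^ n"
    have s: "0 < s" using y by (simp add: s_def)
    have "H * h y s \<le> H * (2 * K * s)"
      using H(1) hole_fun_le[OF s] by (intro mult_left_mono) auto
    then have "\<delta> y \<le> H * (2 * K) * s" using near n(2) by (simp add: s_def mult_ac)
    then have far: "\<delta> z \<le> L * h y s" if "z \<in> B y s" for z
      using L(2) y(1) s that by blast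
    have "B y s \<subseteq> near (2 * L * t)"
    proof
      fix z assume z: "z \<in> B y s"
      have "L * h y s \<le> L * t" using L(1) n(1) by (intro mult_left_mono) (auto simp: s_def)
      also have "\<dots> < 2 * L * t" using L(1) t by simp
      finally show "z \<in> near (2 * L * t)" using far[OF z] z by (auto simp: near_def qball_def)
    qed
    moreover have "measure M (B y s) \<le> Q * measure M (B y s - near (\<gamma> / H * t))"
    proof -
      have "\<gamma> * t \<le> \<gamma> * (H * h y s)" using n(2) Q(2) by (intro mult_left_mono) (auto simp: s_def)
      then have "\<gamma> / H * t \<le> \<gamma> * h y s" using H(1) by (simp add: field_simps)
      then have "near (\<gamma> / H * t) \<subseteq> near (\<gamma> * h y s)" by (rule near_mono)
      then have "measure M (B y s - near (\<gamma> * h y s)) \<le> measure M (B y s - near (\<gamma> / H * t))"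
        using ball_fmeasurable[OF y(1)] near_measurable y(1)
        by (intro measure_mono_fmeasurable fmeasurable_Diff sets.Diff) auto
      then have "Q * measure M (B y s - near (\<gamma> * h y s)) \<le> Q * measure M (B y s - near (\<gamma> / H * t))"
        using Q(1) by (intro mult_left_mono) auto
      with Q(4)[OF y(1) s] show ?thesis by linarith
    qed
    ultimately show ?thesis using n(3) unfolding s_def by blast
  qed
  have "0 < \<gamma> / H" "1 \<le> 2 * L" using Q(2) H(1) L(1) by auto
  then show ?thesis by (rule that[OF H(1) Q(1)]) (fact Q(3), fact annulus)
qed

end

section \<open>Geometric decay of the neighbourhoods of a porous set\<close>

context homogeneous_space_subset
begin

text \<open>Neighbourhoods of a ball of shrinking width: an enlargement of the \<open>Suc i\<close>-th one by
  \<open>r / (2 K)^i\<close> stays inside the \<open>i\<close>-th one, although the quasi-triangle inequality loses a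
  factor \<open>K\<close> in each step.\<close>

definition halo :: "'a \<Rightarrow> real \<Rightarrow> nat \<Rightarrow> 'a set" where
  "halo x r i = (\<Union>y\<in>B x r. B y (2 * K * (r / (2 * K) ^ i)))"

lemma halo_measurable: "halo x r i \<in> sets M"
  unfolding halo_def by (rule UN_balls_measurable[OF ball_subset_space])

lemma ball_subset_halo:
  assumes "0 < r" shows "B x r \<subseteq> halo x r i"
proof
  fix z assume z: "z \<in> B x r"
  have "0 < 2 * K * (r / (2 * K) ^ i)" using assms K_pos by simp
  then have "z \<in> B z (2 * K * (r / (2 * K) ^ i))"
    using z ball_subset_space by (intro center_in_ball) auto
  then show "z \<in> halo x r i" using z unfolding halo_def by blast
qed

lemma halo_subset_ball:
  assumes x: "x \<in> X" and r: "0 < r" shows "halo x r i \<subseteq> B x (3 * K\<^sup>2 * r)"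
proof
  fix z assume "z \<in> halo x r i"
  then obtain y where y: "y \<in> X" "d x y < r" "z \<in> X" "d y z < 2 * K * (r / (2 * K) ^ i)"
    by (auto simp: halo_def qball_def)
  have "1 \<le> (2 * K) ^ i" using K_ge_1 by (intro one_le_power) simp
  then have "r / (2 * K) ^ i \<le> r" using r by (simp add: divide_le_eq mult_le_cancel_left1)
  then have "2 * K * (r / (2 * K) ^ i) \<le> 2 * K * r" using K_pos by (intro mult_left_mono) auto
  then have "d y z < 2 * K * r" using y by linarith
  moreover have "K * (r + 2 * K * r) \<le> 3 * K\<^sup>2 * r"
  proof -
    have "K * 1 \<le> K * K" using K_ge_1 by (intro mult_left_mono) auto
    then have "(K + 2 * K\<^sup>2) * r \<le> 3 * K\<^sup>2 * r"
      using r by (intro mult_right_mono) (auto simp: power2_eq_square)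
    then show ?thesis by (simp add: algebra_simps power2_eq_square)
  qed
  ultimately have "d x z < 3 * K\<^sup>2 * r"
    using x y by (intro d_triangle_less[of x y z r "2 * K * r"]) auto
  then show "z \<in> B x (3 * K\<^sup>2 * r)" using y by (simp add: qball_def)
qed

lemma fmeasurable_in_halo:
  assumes "x \<in> X" "0 < r" "S \<in> sets M" "S \<subseteq> halo x r i"
  shows "S \<in> fmeasurable M"
  using fmeasurable_in_ball[OF assms(3) _ assms(1)] halo_subset_ball[OF assms(1,2), of i] assms(4)
  by blast

lemma ball_subset_halo_pred:
  assumes y: "y \<in> halo x r (Suc i)" and s: "s \<le> r / (2 * K) ^ i"
  shows "B y s \<subseteq> halo x r i"
proof -
  obtain z where z: "z \<in> B x r" "y \<in> X" "d z y < 2 * K * (r / (2 * K) ^ Suc i)"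
    using y by (auto simp: halo_def qball_def)
  have "d z y < r / (2 * K) ^ i" using z(3) K_pos by simp
  moreover have "K * (r / (2 * K) ^ i + s) \<le> 2 * K * (r / (2 * K) ^ i)"
  proof -
    have "K * (e + s) \<le> 2 * K * e" if "s \<le> e" for e
      using mult_left_mono[OF that, of K] K_pos by (simp add: algebra_simps)
    then show ?thesis using s by blast
  qed
  ultimately have "B y s \<subseteq> B z (2 * K * (r / (2 * K) ^ i))"
    using z ball_subset_space by (intro ball_subset_ball[of z y "r / (2 * K) ^ i"]) auto
  then show ?thesis using z(1) unfolding halo_def by blast
qed

lemma halo_Suc_subset:
  assumes "0 < r" shows "halo x r (Suc i) \<subseteq> halo x r i"
proof
  fix y assume y: "y \<in> halo x r (Suc i)"
  then have "y \<in> X" by (auto simp: halo_def qball_def)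
  then have "y \<in> B y (r / (2 * K) ^ i)" using assms K_pos by (intro center_in_ball) auto
  then show "y \<in> halo x r i" using ball_subset_halo_pred[OF y order_refl] by blast
qed

text \<open>Cover the part of a thin neighbourhood of \<open>E\<close> by the balls of
  \<open>ball_in_annulus\<close>. A fixed
  fraction of these balls lies in an annulus around \<open>E\<close>, so that the annulus carries a fixed fraction of
  the measure of the thin neighbourhood. The condition on \<open>t\<close> makes the balls small enough to stay in
  the next larger halo: halving a radius reduces the hole function by at most a factor \<open>H\<close>, so \<open>n\<close>
  halvings were needed with \<open>H ^ n\<close> at least the ratio \<open>h x r / t\<close>.\<close>

lemma near_measure_step:
  assumes "weakly_porous X d M E" "hole_doubling X d E"
  obtains P Q l L where "1 < P" "0 < Q" "0 < l" "1 \<le> L"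
    "\<And>x r. x \<in> X \<Longrightarrow> 0 < r \<Longrightarrow> 0 < h x r"
    "\<And>x r t i. \<lbrakk>x \<in> X; 0 < r; 0 < t; t * P ^ Suc i \<le> h x r\<rbrakk> \<Longrightarrow>
      measure M (halo x r (Suc i) \<inter> near t) \<le> Q * measure M (halo x r i \<inter> near (L * t) - near (l * t))"
proof -
  obtain H Q l L where H: "1 < H" and Q: "0 < Q" and l: "0 < l" and L: "1 \<le> L" and
    h_pos: "\<And>x r. x \<in> X \<Longrightarrow> 0 < r \<Longrightarrow> 0 < h x r" and
    annulus: "\<And>y R t. \<lbrakk>y \<in> X; 0 < R; 0 < t; t < h y R; \<delta> y < t\<rbrakk> \<Longrightarrow>
      \<exists>n. h y R \<le> H ^ n * t \<and> B y (R / 2 ^ n) \<subseteq> near (L * t) \<and>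
        measure M (B y (R / 2 ^ n)) \<le> Q * measure M (B y (R / 2 ^ n) - near (l * t))"
    using ball_in_annulus[OF assms] by metis
  obtain C where C: "1 \<le> C"
    "\<And>S f R x r. \<lbrakk>S \<in> sets M; x \<in> X; \<And>y. y \<in> S \<Longrightarrow> 0 < f y \<and> f y \<le> R \<and> B y (f y) \<subseteq> B x r\<rbrakk> \<Longrightarrow>
      \<exists>J\<subseteq>S. finite J \<and> disjoint_family_on (\<lambda>y. B y (f y)) J \<and>
        measure M S \<le> C * (\<Sum>y\<in>J. measure M (B y (f y)))"
    using finite_vitali by blast
  \<comment> \<open>At least \<open>m * Suc i\<close> halvings will be needed, and they reduce \<open>4 * K ^ 3 * r\<close> to at most
    \<open>r / (2 * K) ^ i\<close>; therefore \<open>P = H ^ m\<close>.\<close>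
  obtain m where m: "4 * K ^ 3 < 2 ^ m" using real_arch_pow[of 2 "4 * K ^ 3"] by auto
  have K3: "K \<le> K ^ 3" using power_increasing[of 1 3 K] K_ge_1 by simp
  have m2: "2 * K \<le> 2 ^ m" using m K3 K_pos by linarith
  have "m \<noteq> 0"
  proof
    assume "m = 0" with m K3 K_ge_1 show False by simp
  qed
  have P: "1 < H ^ m" using H \<open>m \<noteq> 0\<close> by (simp add: one_less_power)
  have step: "measure M (halo x r (Suc i) \<inter> near t) \<le>
      C * Q * measure M (halo x r i \<inter> near (L * t) - near (l * t))"
    if x: "x \<in> X" and r: "0 < r" and t: "0 < t" and small: "t * (H ^ m) ^ Suc i \<le> h x r" for x r t i
  proof -
    define S where "S = halo x r (Suc i) \<inter> near t"
    have S: "S \<in> sets M" using halo_measurable near_measurable by (simp add: S_def)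
    have SX: "S \<subseteq> X" using S sets.sets_into_space space_eq by blast
    \<comment> \<open>Large enough for the ball around any point of the halo to contain \<open>B x r\<close>.\<close>
    define R where "R = 4 * K ^ 3 * r"
    have R: "0 < R" using r K_pos by (simp add: R_def)
    have ex: "\<exists>s. 0 < s \<and> s \<le> r / (2 * K) ^ i \<and> B y s \<subseteq> near (L * t) \<and>
        measure M (B y s) \<le> Q * measure M (B y s - near (l * t))" if y: "y \<in> S" for y
    proof -
      have yX: "y \<in> X" using y SX by blast
      have "y \<in> B x (3 * K\<^sup>2 * r)" using y halo_subset_ball[OF x r] by (auto simp: S_def)
      then have "d y x < 3 * K\<^sup>2 * r" using x by (auto simp: qball_def d_commute)
      moreover have "K * (3 * K\<^sup>2 * r + r) \<le> R"
      proof -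
        have "K * r \<le> K ^ 3 * r" using K3 r by (intro mult_right_mono) auto
        then show ?thesis by (simp add: R_def algebra_simps power2_eq_square power3_eq_cube)
      qed
      ultimately have sub: "B x r \<subseteq> B y R" using yX x by (intro ball_subset_ball)
      have "1 * r \<le> 4 * K ^ 3 * r" using K3 K_ge_1 r by (intro mult_right_mono) auto
      then have "h x r \<le> h y R" using sub by (intro hole_fun_mono) (auto simp: R_def)
      have "t * 1 < t * (H ^ m) ^ Suc i" using t one_less_power[OF P, of "Suc i"] by (intro mult_strict_left_mono) auto
      then have "t < h y R" using small \<open>h x r \<le> h y R\<close> by linarith
      moreover have "\<delta> y < t" using y by (auto simp: S_def near_def)
      ultimately obtain n where n: "h y R \<le> H ^ n * t" "B y (R / 2 ^ n) \<subseteq> near (L * t)"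
        "measure M (B y (R / 2 ^ n)) \<le> Q * measure M (B y (R / 2 ^ n) - near (l * t))"
        using annulus[OF yX R t] by blast
      have "t * (H ^ m) ^ Suc i \<le> t * H ^ n"
        using small \<open>h x r \<le> h y R\<close> n(1) mult.commute[of t "H ^ n"] by linarith
      then have "t * H ^ (m * Suc i) \<le> t * H ^ n" by (simp only: power_mult)
      then have "m * Suc i \<le> n" using t H by (simp add: power_increasing_iff)
      then have "(2::real) ^ (m * Suc i) \<le> 2 ^ n" by (intro power_increasing) auto
      then have "(2 ^ m) ^ Suc i \<le> (2::real) ^ n" by (simp only: power_mult)
      moreover have "4 * K ^ 3 * (2 * K) ^ i \<le> 2 ^ m * (2 ^ m) ^ i"
        using m m2 K_pos by (intro mult_mono power_mono) auto
      ultimately have "4 * K ^ 3 * (2 * K) ^ i \<le> 2 ^ n" by simp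
      then have "r * (4 * K ^ 3 * (2 * K) ^ i) \<le> r * 2 ^ n" using r by (intro mult_left_mono) auto
      then have "R / 2 ^ n \<le> r / (2 * K) ^ i"
        using K_pos by (simp add: R_def divide_le_eq le_divide_eq mult_ac)
      then show ?thesis using R n(2,3) by (intro exI[of _ "R / 2 ^ n"]) simp
    qed
    then obtain f where f: "\<And>y. y \<in> S \<Longrightarrow> 0 < f y \<and> f y \<le> r / (2 * K) ^ i \<and> B y (f y) \<subseteq> near (L * t) \<and>
        measure M (B y (f y)) \<le> Q * measure M (B y (f y) - near (l * t))"
      by metis
    have f_halo: "B y (f y) \<subseteq> halo x r i" if "y \<in> S" for y
      using f[OF that] that by (intro ball_subset_halo_pred) (auto simp: S_def)
    have f_ball: "0 < f y \<and> f y \<le> r / (2 * K) ^ i \<and> B y (f y) \<subseteq> B x (3 * K\<^sup>2 * r)" if "y \<in> S" for y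
      using f[OF that] f_halo[OF that] halo_subset_ball[OF x r, of i] by blast
    obtain J where J: "J \<subseteq> S" "finite J" "disjoint_family_on (\<lambda>y. B y (f y)) J"
      "measure M S \<le> C * (\<Sum>y\<in>J. measure M (B y (f y)))"
      using C(2)[OF S x f_ball] by blast
    define U where "U y = B y (f y) - near (l * t)" for y
    have U: "U y \<in> fmeasurable M" if "y \<in> J" for y
      using that J(1) SX ball_fmeasurable near_measurable unfolding U_def
      by (intro fmeasurable_Diff) auto
    have "measure M S \<le> C * (\<Sum>y\<in>J. measure M (B y (f y)))" by (fact J(4))
    also have "\<dots> \<le> C * (\<Sum>y\<in>J. Q * measure M (U y))"
      using C(1) f J(1) unfolding U_def by (intro mult_left_mono sum_mono) auto
    also have "\<dots> = C * Q * measure M (\<Union>y\<in>J. U y)"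
      using measure_UN_disjoint_family[OF J(2,3) _ U] by (simp add: U_def sum_distrib_left mult_ac)
    also have "\<dots> \<le> C * Q * measure M (halo x r i \<inter> near (L * t) - near (l * t))"
    proof (intro mult_left_mono measure_mono_fmeasurable)
      show "(\<Union>y\<in>J. U y) \<subseteq> halo x r i \<inter> near (L * t) - near (l * t)"
        using f f_halo J(1) unfolding U_def by blast
      show "(\<Union>y\<in>J. U y) \<in> sets M" using J(2) U by auto
      show "halo x r i \<inter> near (L * t) - near (l * t) \<in> fmeasurable M"
        using halo_measurable near_measurable by (intro fmeasurable_in_halo[OF x r, of _ i]) auto
    qed (use C(1) Q in auto)
    finally show ?thesis by (simp add: S_def)
  qed
  show ?thesis
  proof (rule that[of "H ^ m" "C * Q" l L])
    show "0 < C * Q" using C(1) Q by simp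
  qed (fact P l L h_pos step)+
qed

text \<open>Iterating the previous lemma: each step towards \<open>E\<close> removes an annulus of comparable
  measure, so the measure of the neighbourhoods of \<open>E\<close> decays geometrically.\<close>

lemma near_measure_decay:
  assumes "weakly_porous X d M E" "hole_doubling X d E"
  obtains \<tau> \<theta> \<eta> Q where "0 < \<tau>" "\<tau> < 1" "0 < \<theta>" "\<theta> < 1" "0 < \<eta>" "0 < Q"
    "\<And>x r. x \<in> X \<Longrightarrow> 0 < r \<Longrightarrow> 0 < h x r"
    "\<And>x r i. x \<in> X \<Longrightarrow> 0 < r \<Longrightarrow>
      measure M (B x r \<inter> near (\<tau> ^ i * (\<eta> * h x r))) \<le> Q * \<theta> ^ i * measure M (B x r)"
proof -
  obtain P Q l L where P: "1 < P" and Q: "0 < Q" and l: "0 < l" and L: "1 \<le> L" and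
    h_pos: "\<And>x r. x \<in> X \<Longrightarrow> 0 < r \<Longrightarrow> 0 < h x r" and
    step: "\<And>x r t i. \<lbrakk>x \<in> X; 0 < r; 0 < t; t * P ^ Suc i \<le> h x r\<rbrakk> \<Longrightarrow>
      measure M (halo x r (Suc i) \<inter> near t) \<le> Q * measure M (halo x r i \<inter> near (L * t) - near (l * t))"
    using near_measure_step[OF assms] by metis
  obtain D where D: "1 \<le> D"
    "\<And>x r. x \<in> X \<Longrightarrow> 0 < r \<Longrightarrow> measure M (B x (3 * K\<^sup>2 * r)) \<le> D * measure M (B x r)"
    using measure_doubling by blast
  \<comment> \<open>With \<open>t\<close> the \<open>i\<close>-th threshold divided by \<open>L\<close>, the first two bounds put the next threshold
    below \<open>l * t\<close> and \<open>t\<close>; the third keeps the smallness condition on \<open>t\<close> valid for all \<open>i\<close>.\<close>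
  define \<tau> where "\<tau> = min (l / L) (min (1 / L) (1 / P))"
  have \<tau>: "0 < \<tau>" "\<tau> \<le> l / L" "\<tau> \<le> 1 / L" "\<tau> \<le> 1 / P" using l L P by (auto simp: \<tau>_def)
  have "1 / P < 1" using P by simp
  then have "\<tau> < 1" using \<tau>(4) by linarith
  define \<theta> where "\<theta> = Q / (1 + Q)"
  have \<theta>: "0 < \<theta>" "\<theta> < 1" using Q by (auto simp: \<theta>_def)
  have decay: "measure M (B x r \<inter> near (\<tau> ^ i * (1 / P * h x r))) \<le> D * \<theta> ^ i * measure M (B x r)"
    if x: "x \<in> X" and r: "0 < r" for x r i
  proof -
    define T where "T i = \<tau> ^ i * (1 / P * h x r)" for i
    have T: "0 < T i" for i using \<tau> P h_pos[OF x r] by (simp add: T_def)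
    define F where "F i = halo x r i \<inter> near (T i)" for i
    have F: "F i \<in> fmeasurable M" for i
      using halo_measurable near_measurable by (intro fmeasurable_in_halo[OF x r, of _ i]) (auto simp: F_def)
    have F_Suc: "measure M (F (Suc i)) \<le> \<theta> * measure M (F i)" for i
    proof -
      define t where "t = T i / L"
      have t: "0 < t" "L * t = T i" using T L by (auto simp: t_def)
      have TSuc: "T (Suc i) = \<tau> * T i" by (simp add: T_def)
      have "T (Suc i) \<le> 1 / L * T i" "T (Suc i) \<le> l / L * T i"
        unfolding TSuc using \<tau> T[of i] by (intro mult_right_mono; simp)+
      then have near: "near (T (Suc i)) \<subseteq> near t" "near (T (Suc i)) \<subseteq> near (l * t)"
        by (auto intro!: near_mono simp: t_def)
      have "t * P ^ Suc i \<le> h x r"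
      proof -
        have "\<tau> ^ i * P ^ i \<le> 1"
        proof -
          have "\<tau> * P \<le> 1" using \<tau>(4) P by (simp add: field_simps)
          then have "(\<tau> * P) ^ i \<le> 1" using \<tau>(1) P by (intro power_le_one) auto
          then show ?thesis by (simp add: power_mult_distrib)
        qed
        moreover have "t * P ^ Suc i = \<tau> ^ i * P ^ i * (h x r / L)"
          using P by (simp add: t_def T_def)
        ultimately have "t * P ^ Suc i \<le> 1 * (h x r / L)"
          using h_pos[OF x r] L by (metis divide_nonneg_pos less_eq_real_def less_le_trans mult_right_mono zero_less_one)
        also have "\<dots> \<le> h x r" using h_pos[OF x r] L by (simp add: divide_le_eq)
        finally show ?thesis .
      qed
      then have *: "measure M (halo x r (Suc i) \<inter> near t) \<le> Q * measure M (halo x r i \<inter> near (L * t) - near (l * t))"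
        using step[OF x r t(1)] by blast
      have "measure M (F (Suc i)) \<le> measure M (halo x r (Suc i) \<inter> near t)"
        using near(1) halo_measurable near_measurable
        by (intro measure_mono_fmeasurable fmeasurable_in_halo[OF x r, of _ "Suc i"]) (auto simp: F_def)
      also have "\<dots> \<le> Q * measure M (halo x r i \<inter> near (L * t) - near (l * t))" by (fact *)
      also have "\<dots> \<le> Q * measure M (F i - F (Suc i))"
      proof (intro mult_left_mono measure_mono_fmeasurable)
        show "halo x r i \<inter> near (L * t) - near (l * t) \<subseteq> F i - F (Suc i)"
          using near(2) unfolding t(2) F_def by blast
        show "halo x r i \<inter> near (L * t) - near (l * t) \<in> sets M"
          using halo_measurable near_measurable by auto
        show "F i - F (Suc i) \<in> fmeasurable M" using F by (intro fmeasurable_Diff) auto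
      qed (use Q in auto)
      also have "measure M (F i - F (Suc i)) = measure M (F i) - measure M (F (Suc i))"
      proof (rule measurable_measure_Diff)
        have "T (Suc i) \<le> T i" unfolding TSuc using \<open>\<tau> < 1\<close> T[of i] by simp
        then show "F (Suc i) \<subseteq> F i"
          using halo_Suc_subset[OF r] near_mono unfolding F_def by blast
      qed (use F in auto)
      finally have "(1 + Q) * measure M (F (Suc i)) \<le> Q * measure M (F i)" by (simp add: algebra_simps)
      then show ?thesis using Q by (simp add: \<theta>_def field_simps)
    qed
    have "measure M (F i) \<le> \<theta> ^ i * measure M (B x (3 * K\<^sup>2 * r))"
    proof (induction i)
      case 0
      have "measure M (F 0) \<le> measure M (B x (3 * K\<^sup>2 * r))"
        using halo_subset_ball[OF x r] F ball_fmeasurable[OF x]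
        by (intro measure_mono_fmeasurable) (auto simp: F_def)
      then show ?case by simp
    next
      case (Suc i)
      have "measure M (F (Suc i)) \<le> \<theta> * measure M (F i)" by (fact F_Suc)
      also have "\<dots> \<le> \<theta> * (\<theta> ^ i * measure M (B x (3 * K\<^sup>2 * r)))"
        using Suc.IH \<theta> by (intro mult_left_mono) auto
      finally show ?case by (simp add: mult_ac)
    qed
    also have "\<dots> \<le> \<theta> ^ i * (D * measure M (B x r))"
      using D(2)[OF x r] \<theta> by (intro mult_left_mono) auto
    finally have "measure M (F i) \<le> D * \<theta> ^ i * measure M (B x r)" by (simp add: mult_ac)
    moreover have "measure M (B x r \<inter> near (T i)) \<le> measure M (F i)"
      using ball_subset_halo[OF r] F ball_measurable[OF x] near_measurable
      by (intro measure_mono_fmeasurable) (auto simp: F_def)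
    ultimately show ?thesis by (simp add: T_def)
  qed
  show ?thesis
  proof (rule that[of \<tau> \<theta> "1 / P" D])
    show "0 < 1 / P" "0 < D" using P D(1) by auto
  qed (fact \<tau>(1) \<open>\<tau> < 1\<close> \<theta> h_pos decay)+
qed

end

section \<open>From porosity and doubling holes to the Muckenhoupt condition\<close>

lemma suminf_ennreal_eq_top:
  fixes f :: "nat \<Rightarrow> ennreal"
  assumes "0 < c" "\<And>i. ennreal c \<le> f i"
  shows "suminf f = top"
proof (rule ccontr)
  assume "suminf f \<noteq> top"
  then obtain s where s: "suminf f = ennreal s" "0 \<le> s" by (cases "suminf f") auto
  obtain n where n: "s / c < real n" using reals_Archimedean2 by blast
  have "ennreal (real n * c) = (\<Sum>i<n. ennreal c)" using assms(1) by (simp add: ennreal_mult ennreal_of_nat_eq_real_of_nat)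
  also have "\<dots> \<le> (\<Sum>i<n. f i)" using assms(2) by (intro sum_mono)
  also have "\<dots> \<le> suminf f" by (intro sum_le_suminf) auto
  finally have "real n * c \<le> s" using s by simp
  with n assms(1) show False by (simp add: field_simps)
qed

context homogeneous_space_subset
begin

text \<open>Each point at distance less than \<open>u\<close> from \<open>E\<close> lies in one of the layers where the distance is
  between \<open>\<tau> ^ Suc i * u\<close> and \<open>\<tau> ^ i * u\<close>; on the closure of \<open>E\<close> all terms of the series
  contribute and it diverges.\<close>

lemma w_le_layers:
  assumes z: "z \<in> X" and u: "0 < u" and \<tau>: "0 < \<tau>" "\<tau> < 1" and \<alpha>: "0 < \<alpha>"
  shows "w \<alpha> z \<le> ennreal (u powr - \<alpha>) +
    (\<Sum>i. ennreal ((\<tau> ^ Suc i * u) powr - \<alpha>) * indicator (near (\<tau> ^ i * u)) z)"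
    (is "_ \<le> _ + suminf ?f")
proof -
  consider "u \<le> \<delta> z" | "\<delta> z = 0" | "0 < \<delta> z" "\<delta> z < u"
    using dist_nonneg[OF z] by fastforce
  then show ?thesis
  proof cases
    case 1
    then show ?thesis using w_le[OF u 1 \<alpha>] by (simp add: add_increasing2)
  next
    case 2
    have "suminf ?f = top"
    proof (rule suminf_ennreal_eq_top)
      show "0 < u powr - \<alpha>" using u by simp
      fix i
      have "z \<in> near (\<tau> ^ i * u)" using 2 z u \<tau> by (simp add: near_def)
      moreover have "\<tau> ^ Suc i * u \<le> u"
        using u \<tau> mult_right_mono[OF power_le_one[of \<tau> "Suc i"], of u] by simp
      then have "u powr - \<alpha> \<le> (\<tau> ^ Suc i * u) powr - \<alpha>" using u \<tau> \<alpha> by (intro powr_mono2') auto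
      ultimately show "ennreal (u powr - \<alpha>) \<le> ?f i" by (simp add: ennreal_leI)
    qed
    then show ?thesis by simp
  next
    case 3
    define P where "P n \<longleftrightarrow> \<tau> ^ n * u \<le> \<delta> z" for n
    obtain n0 where "\<tau> ^ n0 < \<delta> z / u" using real_arch_pow_inv[of "\<delta> z / u" \<tau>] 3 u \<tau> by auto
    then have "P n0" using u by (simp add: P_def field_simps)
    define n where "n = (LEAST n. P n)"
    have Pn: "P n" unfolding n_def using \<open>P n0\<close> by (rule LeastI)
    moreover have "\<not> P 0" using 3 by (simp add: P_def)
    ultimately obtain i where i: "n = Suc i" by (cases n) auto
    then have "\<not> P i" using not_less_Least[of i P] by (simp add: n_def)
    then have "z \<in> near (\<tau> ^ i * u)" using z by (simp add: P_def near_def)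
    moreover have "w \<alpha> z \<le> ennreal ((\<tau> ^ Suc i * u) powr - \<alpha>)"
      using Pn u \<tau> \<alpha> unfolding P_def i by (intro w_le) auto
    ultimately have "w \<alpha> z \<le> ?f i" by simp
    also have "\<dots> \<le> suminf ?f"
    proof -
      have "g i \<le> suminf g" for g :: "nat \<Rightarrow> ennreal"
        using sum_le_suminf[of g "{i}"] by simp
      then show ?thesis .
    qed
    finally show ?thesis by (simp add: add_increasing)
  qed
qed

text \<open>The exponent is chosen so small that the decay of the measure of the layers beats the growth
  of the weight on them.\<close>

lemma nn_integral_w_le:
  assumes "weakly_porous X d M E" "hole_doubling X d E"
  obtains \<alpha> C where "0 < \<alpha>" "0 < C"
    "\<And>x r. x \<in> X \<Longrightarrow> 0 < r \<Longrightarrow> 0 < h x r \<and>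
      set_nn_integral M (B x r) (w \<alpha>) \<le> ennreal (C * h x r powr - \<alpha> * measure M (B x r))"
proof -
  obtain \<tau> \<theta> \<eta> Q where \<tau>: "0 < \<tau>" "\<tau> < 1" and \<theta>: "0 < \<theta>" "\<theta> < 1" and \<eta>: "0 < \<eta>" and Q: "0 < Q" and
    h_pos: "\<And>x r. x \<in> X \<Longrightarrow> 0 < r \<Longrightarrow> 0 < h x r" and
    decay: "\<And>x r i. x \<in> X \<Longrightarrow> 0 < r \<Longrightarrow>
      measure M (B x r \<inter> near (\<tau> ^ i * (\<eta> * h x r))) \<le> Q * \<theta> ^ i * measure M (B x r)"
    using near_measure_decay[OF assms] by metis
  \<comment> \<open>The solution of \<open>\<tau> powr - \<alpha> * \<theta> = sqrt \<theta>\<close>.\<close>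
  define \<alpha> where "\<alpha> = ln \<theta> / (2 * ln \<tau>)"
  have \<alpha>: "0 < \<alpha>" using \<tau> \<theta> by (simp add: \<alpha>_def zero_less_divide_iff)
  define b where "b = \<tau> powr - \<alpha>"
  have b: "0 < b" using \<tau> by (simp add: b_def)
  have "b = exp (- (ln \<theta> / 2))" using \<tau> by (simp add: b_def powr_def \<alpha>_def)
  then have "b * \<theta> = exp (- (ln \<theta> / 2)) * exp (ln \<theta>)" using \<theta> by simp
  also have "\<dots> = exp (- (ln \<theta> / 2) + ln \<theta>)" by (rule exp_add[symmetric])
  also have "- (ln \<theta> / 2) + ln \<theta> = ln \<theta> / 2" by simp
  finally have b\<theta>: "b * \<theta> < 1" using \<theta> by simp
  define C0 where "C0 = 1 + b * Q / (1 - b * \<theta>)"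
  have C0: "0 < C0" using b\<theta> b Q by (simp add: C0_def add_pos_nonneg)
  have bound: "set_nn_integral M (B x r) (w \<alpha>) \<le> ennreal (\<eta> powr - \<alpha> * C0 * h x r powr - \<alpha> * measure M (B x r))"
    if x: "x \<in> X" and r: "0 < r" for x r
  proof -
    define u where "u = \<eta> * h x r"
    have u: "0 < u" using \<eta> h_pos[OF x r] by (simp add: u_def)
    define V where "V = u powr - \<alpha>"
    have V: "0 < V" using u by (simp add: V_def)
    define \<mu> where "\<mu> = measure M (B x r)"
    have \<mu>: "0 \<le> \<mu>" "emeasure M (B x r) = ennreal \<mu>"
      using ball_fmeasurable[OF x] by (auto simp: \<mu>_def emeasure_eq_measure2)
    define a where "a i = (\<tau> ^ Suc i * u) powr - \<alpha>" for i
    have a: "0 \<le> a i" "a i = V * b * b ^ i" for i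
    proof -
      have "(\<tau> ^ n) powr - \<alpha> = b ^ n" for n
        using \<tau> by (induction n) (auto simp: b_def powr_mult)
      from this[of "Suc i"] show "a i = V * b * b ^ i" using \<tau> u by (simp add: a_def V_def powr_mult)
    qed (simp add: a_def)
    note [measurable] = near_measurable ball_measurable[OF x]
    have "set_nn_integral M (B x r) (w \<alpha>) \<le>
        (\<integral>\<^sup>+z. ennreal V * indicator (B x r) z +
          (\<Sum>i. ennreal (a i) * indicator (B x r \<inter> near (\<tau> ^ i * u)) z) \<partial>M)"
    proof (rule nn_integral_mono)
      fix z assume "z \<in> space M"
      then have "z \<in> X" by (simp add: space_eq)
      then show "w \<alpha> z * indicator (B x r) z \<le> ennreal V * indicator (B x r) z +
          (\<Sum>i. ennreal (a i) * indicator (B x r \<inter> near (\<tau> ^ i * u)) z)"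
        using w_le_layers[OF _ u \<tau> \<alpha>, of z]
        by (cases "z \<in> B x r") (simp_all add: V_def a_def indicator_inter_arith)
    qed
    also have "\<dots> = ennreal V * ennreal \<mu> +
        (\<Sum>i. ennreal (a i) * emeasure M (B x r \<inter> near (\<tau> ^ i * u)))"
      by (simp add: nn_integral_add nn_integral_suminf nn_integral_cmult_indicator \<mu>)
    also have "\<dots> \<le> ennreal V * ennreal \<mu> + (\<Sum>i. ennreal (V * b * Q * \<mu> * (b * \<theta>) ^ i))"
    proof (intro add_left_mono suminf_le)
      fix i
      have "emeasure M (B x r \<inter> near (\<tau> ^ i * u)) = ennreal (measure M (B x r \<inter> near (\<tau> ^ i * u)))"
        using ball_fmeasurable[OF x] near_measurable
        by (intro emeasure_eq_measure2 fmeasurable_Int_fmeasurable)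
      also have "ennreal (a i) * \<dots> \<le> ennreal (a i) * ennreal (Q * \<theta> ^ i * \<mu>)"
        using decay[OF x r, of i] by (intro mult_left_mono ennreal_leI) (auto simp: u_def \<mu>_def)
      also have "\<dots> = ennreal (V * b * Q * \<mu> * (b * \<theta>) ^ i)"
        using a Q \<theta> \<mu> by (simp add: ennreal_mult[symmetric] power_mult_distrib mult_ac)
      finally show "ennreal (a i) * emeasure M (B x r \<inter> near (\<tau> ^ i * u)) \<le> ennreal (V * b * Q * \<mu> * (b * \<theta>) ^ i)" .
    qed auto
    also have "(\<Sum>i. ennreal (V * b * Q * \<mu> * (b * \<theta>) ^ i)) = ennreal (V * b * Q * \<mu> * (1 / (1 - b * \<theta>)))"
    proof (rule suminf_ennreal_eq)
      show "(\<lambda>i. V * b * Q * \<mu> * (b * \<theta>) ^ i) sums (V * b * Q * \<mu> * (1 / (1 - b * \<theta>)))"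
        using b\<theta> b \<theta> by (intro sums_mult geometric_sums) auto
    qed (use V b Q \<mu> \<theta> in auto)
    also have "ennreal V * ennreal \<mu> + \<dots> = ennreal (V * C0 * \<mu>)"
      using V b Q \<mu> b\<theta> by (simp add: ennreal_mult[symmetric] ennreal_plus[symmetric] C0_def algebra_simps del: ennreal_plus)
    also have "V = \<eta> powr - \<alpha> * h x r powr - \<alpha>"
      using \<eta> h_pos[OF x r] by (simp add: V_def u_def powr_mult)
    finally show ?thesis by (simp add: \<mu>_def mult_ac)
  qed
  show ?thesis
  proof (rule that[of \<alpha> "\<eta> powr - \<alpha> * C0"])
    show "0 < \<eta> powr - \<alpha> * C0" using \<eta> C0 by simp
  qed (use \<alpha> bound h_pos in blast)+
qed

text \<open>The form in which the \<open>A\<^sub>1\<close> condition is verified: the value \<open>v\<close> mediates between the average and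
  the essential infimum. Allowing \<open>C \<le> C'\<close> lets balls near to and far from \<open>E\<close> share one constant.\<close>

lemma ball_average_le_ess_inf:
  assumes x: "x \<in> X" "0 < r" and C: "0 \<le> C" "C \<le> C'" and v: "0 \<le> v"
    and ge: "\<And>z. z \<in> B x r \<Longrightarrow> ennreal v \<le> f z"
    and le: "set_nn_integral M (B x r) f \<le> ennreal (C * v * measure M (B x r))"
  shows "set_nn_integral M (B x r) f / emeasure M (B x r) \<le> ennreal C' * ess_inf_on M (B x r) f"
    and "set_nn_integral M (B x r) f < \<infinity>"
proof -
  define \<mu> where "\<mu> = measure M (B x r)"
  have \<mu>: "0 < \<mu>" "emeasure M (B x r) = ennreal \<mu>"
    using ball_fmeasurable[OF x(1)] measure_ball_pos[OF x] by (auto simp: \<mu>_def emeasure_eq_measure2)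
  have "ennreal v \<le> ess_inf_on M (B x r) f"
    unfolding ess_inf_on_def using ge by (intro Sup_upper) simp
  then have *: "ennreal (C' * v) \<le> ennreal C' * ess_inf_on M (B x r) f"
    using C v by (simp add: ennreal_mult mult_left_mono)
  have "C * v * \<mu> \<le> \<mu> * (C' * v)" using C v \<mu>(1) by (simp add: mult_right_mono mult_ac)
  then have "set_nn_integral M (B x r) f \<le> ennreal (\<mu> * (C' * v))"
    using le by (auto simp: \<mu>_def intro: order_trans ennreal_leI)
  also have "\<dots> = ennreal \<mu> * ennreal (C' * v)" using \<mu>(1) by (simp add: ennreal_mult')
  finally have "set_nn_integral M (B x r) f / emeasure M (B x r) \<le> ennreal (C' * v)"
    using \<mu> by (intro divide_le_posI_ennreal) auto
  with * show "set_nn_integral M (B x r) f / emeasure M (B x r) \<le> ennreal C' * ess_inf_on M (B x r) f"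
    by (rule order_trans[rotated])
  show "set_nn_integral M (B x r) f < \<infinity>" using le by (rule le_less_trans) simp
qed

text \<open>Balls whose centre is at distance at most \<open>2 * K * r\<close> from \<open>E\<close> use the integral bound, since there the
  distance to \<open>E\<close> is controlled by the hole function; all other balls are elementary.\<close>

lemma porous_doubling_imp_A1:
  assumes "weakly_porous X d M E" "hole_doubling X d E"
  obtains \<alpha> where "0 < \<alpha>" "w \<alpha> \<in> A1_class X d M"
proof -
  obtain \<alpha> C where \<alpha>: "0 < \<alpha>" and C: "0 < C" and
    int: "\<And>x r. x \<in> X \<Longrightarrow> 0 < r \<Longrightarrow> 0 < h x r \<and>
      set_nn_integral M (B x r) (w \<alpha>) \<le> ennreal (C * h x r powr - \<alpha> * measure M (B x r))"
    using nn_integral_w_le[OF assms] by blast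
  have "0 \<le> 2 * K" using K_pos by simp
  then obtain L where L: "1 \<le> L"
    "\<And>x r z. \<lbrakk>x \<in> X; 0 < r; \<delta> x \<le> 2 * K * r; z \<in> B x r\<rbrakk> \<Longrightarrow> \<delta> z \<le> L * h x r"
    using dist_le_hole_fun[OF assms(2)] by blast
  define C1 where "C1 = C * L powr \<alpha>"
  define C2 where "C2 = (4 * K\<^sup>2) powr \<alpha>"
  have C12: "0 < C1" "0 < C2" using C L(1) K_pos by (auto simp: C1_def C2_def)
  have "set_nn_integral M (B x r) (w \<alpha>) / emeasure M (B x r) \<le> ennreal (C1 + C2) * ess_inf_on M (B x r) (w \<alpha>)
      \<and> set_nn_integral M (B x r) (w \<alpha>) < \<infinity>"
    if x: "x \<in> X" and r: "0 < r" for x r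
  proof (cases "\<delta> x \<le> 2 * K * r")
    case True
    define v where "v = (L * h x r) powr - \<alpha>"
    have ge: "ennreal v \<le> w \<alpha> z" if "z \<in> B x r" for z
      unfolding v_def using L(2)[OF x r True that] that \<alpha> by (intro w_ge) (auto simp: qball_def)
    have "C * h x r powr - \<alpha> = C1 * v"
      using L(1) int[OF x r] by (simp add: C1_def v_def powr_mult powr_minus field_simps)
    then have le: "set_nn_integral M (B x r) (w \<alpha>) \<le> ennreal (C1 * v * measure M (B x r))"
      using int[OF x r] by simp
    show ?thesis
      using ball_average_le_ess_inf[OF x r _ _ _ ge le, of "C1 + C2"] C12 by (simp add: v_def)
  next
    case False
    \<comment> \<open>The ball is so far from \<open>E\<close> that the distance to \<open>E\<close> is almost constant on it.\<close>
    then have far: "2 * K * r < \<delta> x" by simp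
    have \<delta>_pos: "0 < \<delta> x" using far r K_pos by (smt (verit) mult_pos_pos)
    define v where "v = (2 * K * \<delta> x) powr - \<alpha>"
    have near: "\<delta> x / (2 * K) \<le> \<delta> z \<and> \<delta> z \<le> 2 * K * \<delta> x" if "z \<in> B x r" for z
    proof
      have z: "z \<in> X" "d x z < r" "d z x < r" using that x by (auto simp: qball_def d_commute)
      have "\<delta> x \<le> K * (d x z + \<delta> z)" using dist_quasi_Lipschitz z x by blast
      also have "\<dots> \<le> K * (r + \<delta> z)" using z K_pos by (intro mult_left_mono) auto
      finally show "\<delta> x / (2 * K) \<le> \<delta> z" using far K_pos by (simp add: field_simps)
      have "r * 1 \<le> r * (2 * K)" using r K_ge_1 by (intro mult_left_mono) auto
      then have "r \<le> \<delta> x" using far by (simp add: mult_ac)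
      have "\<delta> z \<le> K * (d z x + \<delta> x)" using dist_quasi_Lipschitz z x by blast
      also have "\<dots> \<le> K * (\<delta> x + \<delta> x)" using z \<open>r \<le> \<delta> x\<close> K_pos by (intro mult_left_mono) auto
      finally show "\<delta> z \<le> 2 * K * \<delta> x" by simp
    qed
    have ge: "ennreal v \<le> w \<alpha> z" if "z \<in> B x r" for z
      unfolding v_def using near[OF that] that \<alpha> by (intro w_ge) (auto simp: qball_def)
    have "set_nn_integral M (B x r) (w \<alpha>) \<le> (\<integral>\<^sup>+z. ennreal ((\<delta> x / (2 * K)) powr - \<alpha>) * indicator (B x r) z \<partial>M)"
    proof (rule nn_integral_mono)
      fix z
      show "w \<alpha> z * indicator (B x r) z \<le> ennreal ((\<delta> x / (2 * K)) powr - \<alpha>) * indicator (B x r) z"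
        using near[of z] \<alpha> \<delta>_pos K_pos by (cases "z \<in> B x r") (auto intro!: w_le)
    qed
    also have "\<dots> = ennreal ((\<delta> x / (2 * K)) powr - \<alpha> * measure M (B x r))"
      using x ball_fmeasurable[OF x] by (simp add: nn_integral_cmult_indicator emeasure_eq_measure2 ennreal_mult)
    also have "(\<delta> x / (2 * K)) powr - \<alpha> = C2 * v"
    proof -
      have eq: "\<delta> x / (2 * K) = 2 * K * \<delta> x / (4 * K\<^sup>2)" using K_pos by (simp add: power2_eq_square)
      have quot: "(a / b) powr - \<alpha> = b powr \<alpha> * a powr - \<alpha>" if "0 < a" "0 < b" for a b :: real
        using that by (simp add: powr_divide powr_minus_divide)
      show ?thesis
        unfolding eq C2_def v_def using \<delta>_pos K_pos by (intro quot) auto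
    qed
    finally have le: "set_nn_integral M (B x r) (w \<alpha>) \<le> ennreal (C2 * v * measure M (B x r))" .
    show ?thesis
      using ball_average_le_ess_inf[OF x r _ _ _ ge le, of "C1 + C2"] C12 by (simp add: v_def)
  qed
  then have "w \<alpha> \<in> A1_class X d M"
    unfolding A1_class_def weight_def using w_measurable C12
    by (auto intro!: exI[of _ "C1 + C2"])
  then show ?thesis using that \<alpha> by blast
qed

end

section \<open>Weak porosity and the Muckenhoupt condition\<close>

theorem theorem1p1:
  fixes X :: "'a set" and d :: "'a \<Rightarrow> 'a \<Rightarrow> real" and M :: "'a measure" and E :: "'a set"
  assumes "homogeneous_type X d M"
    and "E \<subseteq> X" and "E \<noteq> {}"
  shows "(weakly_porous X d M E \<and> hole_doubling X d E) \<longleftrightarrow>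
         (\<exists>\<alpha>>0. dist_power_weight d E \<alpha> \<in> A1_class X d M)"
proof -
  interpret homogeneous_space_subset X d E M
    using assms by unfold_locales (auto simp: homogeneous_type_def)
  show ?thesis
  proof
    assume "weakly_porous X d M E \<and> hole_doubling X d E"
    then show "\<exists>\<alpha>>0. w \<alpha> \<in> A1_class X d M"
      using porous_doubling_imp_A1 by blast
  next
    assume "\<exists>\<alpha>>0. w \<alpha> \<in> A1_class X d M"
    then show "weakly_porous X d M E \<and> hole_doubling X d E"
      using A1_imp_weakly_porous A1_imp_hole_doubling by blast
  qed
qed

end
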